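(* Assume there is $n\in\mathbb N^*$ (independent of $\omega$) such that $\theta_m=T$ a.s. for all $m\ge n$. Let $\xi=(\xi(\tau))_{\tau\in\Theta}$ be a $p$-integrable admissible family. Let $\rho$ satisfy admissibility, knowledge preservation, monotonicity, consistency and the generalized zero-one law. Define by backward induction $$U(\theta_n):=\xi(\theta_n),\qquad U(\theta_k):=\max\big(\xi(\theta_k),\,\rho_{\theta_k,\theta_{k+1}}[U(\theta_{k+1})]\big)\quad\text{for }k\in\{0,1,\dots,n-1\},$$ and, for $\tau=\sum_{k=0}^n\theta_k\mathbf 1_{A_k}\in\Theta$ with $(A_k)_{0\le k\le n}$ a partition of $\Omega$ such that $A_k\in\mathcal F_{\theta_k}$, set $U(\tau):=\sum_{k=0}^nU(\theta_k)\mathbf 1_{A_k}$. For $\nu\in\Theta$ let $V(\nu):=\operatorname{ess\,sup}_{\tau\in\Theta_\nu}\rho_{\nu,\tau}[\xi(\tau)]$. For $k\in\{0,\dots,n\}$ let $$\bar\nu_k:=\operatorname{ess\,inf}\{\tau\in\Theta_{\theta_k}:U(\tau)=\xi(\tau)\text{ a.s.}\},\qquad \nu_k:=\operatorname{ess\,inf}\{\tau\in\Theta_{\theta_k}:V(\tau)=\xi(\tau)\text{ a.s.}\}.$$ Then, for each $k\in\{0,\dots,n\}$: 1. $U(\theta_k)=\rho_{\theta_k,\bar\nu_k}[\xi(\bar\nu_k)]=V(\theta_k)$ a.s. 2. $U=V$ (i.e. $U(\tau)=V(\tau)$ a.s. for all $\tau\in\Theta$) and $\bar\nu_k=\nu_k$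 a.s.
   Context: Setting. $T>0$ is fixed; $(\Omega,\mathcal F,P)$ is a complete probability space with a right-continuous complete filtration $(\mathcal F_t)_{t\in[0,T]}$. Equalities and inequalities between random variables (and between measurable sets) are understood $P$-a.s. $\mathbb N=\{0,1,2,\dots\}$, $\mathbb N^*=\mathbb N\setminus\{0\}$. $(\theta_k)_{k\in\mathbb N}$ is a sequence of stopping times with $\theta_0=0$, $\theta_k\le\theta_{k+1}$ a.s. for all $k$, and $\lim_{k}\theta_k=T$ a.s. $\Theta$ is the set of stopping times of the form $\tau=\sum_{k=0}^{\infty}\theta_k\mathbf 1_{A_k}+T\mathbf 1_{\bar A}$, where $\{(A_k)_{k\in\mathbb N},\bar A\}$ is a partition of $\Omega$ with $A_k\in\mathcal F_{\theta_k}$ for each $k$ and $\bar A\in\mathcal F_T$; when $\theta_m=T$ for all $m\ge n$, every $\tau\in\Theta$ can be written $\tau=\sum_{k=0}^n\theta_k\mathbf 1_{A_k}$ with $(A_k)_{0\le k\le n}$ a partition, $A_k\in\mathcal F_{\theta_k}$. For $\tau\in\Theta$, $\Theta_\tau=\{\nu\in\Theta:\nu\ge\tau \text{ a.s.}\}$. $p\in[1,+\infty]$ is fixed. (Under admissibility and knowledge preservation of $\rho$, $U(\theta_k)=U(\theta_{k+1})$ a.s. on $\{\theta_k=\theta_{k+1}\}$, so $U(\tau)$ does not depend on the chosen partition.) Families. A family $\phi=(\phi(\tau))_{\tau\in\Theta}$ is admissible if each $\phi(\tau)$ is a real-valued $\mathcal F_\tau$-measurable random variable and $\phi(\tau)=\phi(\tau')$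 a.s. on $\{\tau=\tau'\}$ for all $\tau,\tau'\in\Theta$; it is $p$-integrable if $\phi(\tau)\in L^p$ for all $\tau\in\Theta$. Operators. $\rho=(\rho_{S,\tau})_{S,\tau\in\Theta}$ is a family of (possibly non-linear) operators $\rho_{S,\tau}:L^p(\mathcal F_\tau)\to L^p(\mathcal F_S)$. Properties: - admissibility: $\rho_{S,\tau}[\eta]=\rho_{S',\tau}[\eta]$ a.s. on $\{S=S'\}$, for $S,S',\tau\in\Theta$, $\eta\in L^p(\mathcal F_\tau)$; - knowledge preservation: $\rho_{\tau,S}[\eta]=\eta$ for all $S\in\Theta$, $\tau\in\Theta_S$, $\eta\in L^p(\mathcal F_S)$; - monotonicity: $\rho_{S,\tau}[\eta_1]\le\rho_{S,\tau}[\eta_2]$ a.s. whenever $\eta_1\le\eta_2$ a.s., $\eta_1,\eta_2\in L^p(\mathcal F_\tau)$; - consistency: $\rho_{S,\theta}[\rho_{\theta,\tau}[\eta]]=\rho_{S,\tau}[\eta]$ for all $S,\theta,\tau\in\Theta$ with $S\le\theta\le\tau$ a.s. and $\eta\in L^p(\mathcal F_\tau)$; - generalized zero-one law: $\mathbf 1_A\rho_{S,\tau}[\zeta(\tau)]=\mathbf 1_A\rho_{S,\tau'}[\zeta(\tau')]$ for every $p$-integrable admissible family $\zeta$, $S\in\Theta$, $A\in\mathcal F_S$, and $\tau,\tau'\in\Theta_S$ with $\tau=\tau'$ on $A$. *)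

theory Defs
  imports "HOL-Probability.Probability"
begin

section \<open>Stopping times on the time interval from 0 to T\<close>

text \<open>The filtration is indexed by the interval \<open>{0..T}\<close>; \<open>F t\<close> is irrelevant for other \<open>t\<close>.
  The library notions of stopping time and of \<open>pre_sigma\<close> quantify over the whole index type,
  so they are applied to the filtration extended by \<open>F 0\<close> to the left and by \<open>F T\<close> to the right.
  For \<open>{0..T}\<close>-valued times this gives the usual notions.\<close>

definition frozen :: "real \<Rightarrow> (real \<Rightarrow> 'a measure) \<Rightarrow> real \<Rightarrow> 'a measure" where
  "frozen T F t = F (max 0 (min T t))"

definition stopping_times :: "'a measure \<Rightarrow> (real \<Rightarrow> 'a measure) \<Rightarrow> real \<Rightarrow> ('a \<Rightarrow> real) set" where
  "stopping_times M F T = {\<tau> \<in> space M \<rightarrow> {0..T}. stopping_time (frozen T F) \<tau>}"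

definition F_at :: "'a measure \<Rightarrow> (real \<Rightarrow> 'a measure) \<Rightarrow> real \<Rightarrow> ('a \<Rightarrow> real) \<Rightarrow> 'a measure" where
  "F_at M F T \<tau> = filtration.pre_sigma (space M) (frozen T F) \<tau>"

locale stopping_grid = prob_space M + complete_measure M
  for M :: "'a measure" +
  fixes F :: "real \<Rightarrow> 'a measure" and T :: real and \<theta> :: "nat \<Rightarrow> 'a \<Rightarrow> real"
  assumes T_pos: "0 < T"
    and F_subalgebra: "\<And>t. t \<in> {0..T} \<Longrightarrow> subalgebra M (F t)"
    and F_mono: "\<And>s t. 0 \<le> s \<Longrightarrow> s \<le> t \<Longrightarrow> t \<le> T \<Longrightarrow> sets (F s) \<subseteq> sets (F t)"
    and F_right_continuous: "\<And>t. 0 \<le> t \<Longrightarrow> t < T \<Longrightarrow> sets (F t) = (\<Inter>s\<in>{t<..T}. sets (F s))"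
    and F_complete: "null_sets M \<subseteq> sets (F 0)"
    and theta_stopping: "\<And>k. \<theta> k \<in> stopping_times M F T"
    and theta_0: "AE \<omega> in M. \<theta> 0 \<omega> = 0"
    and theta_mono: "\<And>k. AE \<omega> in M. \<theta> k \<omega> \<le> \<theta> (Suc k) \<omega>"
    and theta_lim: "AE \<omega> in M. (\<lambda>k. \<theta> k \<omega>) \<longlonglongrightarrow> T"

text \<open>The representation of \<open>\<tau>\<close> is an equality of random variables, hence only required almost
  surely. So the set \<open>Theta\<close> contains every \<open>{0..T}\<close>-valued version of each of its elements.\<close>

definition Theta ::
    "'a measure \<Rightarrow> (real \<Rightarrow> 'a measure) \<Rightarrow> real \<Rightarrow> (nat \<Rightarrow> 'a \<Rightarrow> real) \<Rightarrow> ('a \<Rightarrow> real) set" where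
  "Theta M F T \<theta> = {\<tau> \<in> stopping_times M F T. \<exists>A B.
     (\<forall>k. A k \<in> sets (F_at M F T (\<theta> k))) \<and> B \<in> sets (F T) \<and>
     disjoint_family A \<and> (\<forall>k. A k \<inter> B = {}) \<and> (\<Union>k. A k) \<union> B = space M \<and>
     (AE \<omega> in M. \<tau> \<omega> = (\<Sum>k. \<theta> k \<omega> * indicator (A k) \<omega>) + T * indicator B \<omega>)}"

definition Theta_from ::
    "'a measure \<Rightarrow> (real \<Rightarrow> 'a measure) \<Rightarrow> real \<Rightarrow> (nat \<Rightarrow> 'a \<Rightarrow> real) \<Rightarrow> ('a \<Rightarrow> real) \<Rightarrow> ('a \<Rightarrow> real) set" where
  "Theta_from M F T \<theta> \<tau> = {\<nu> \<in> Theta M F T \<theta>. AE \<omega> in M. \<tau> \<omega> \<le> \<nu> \<omega>}"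

section \<open>Integrability and admissible families\<close>

text \<open>Elements of the Lebesgue spaces are represented by functions, not by equivalence classes.\<close>

definition Lp :: "ennreal \<Rightarrow> 'a measure \<Rightarrow> ('a \<Rightarrow> real) set" where
  "Lp p M = {f \<in> borel_measurable M.
     if p = \<top> then esssup M (\<lambda>\<omega>. ereal \<bar>f \<omega>\<bar>) < \<infinity>
     else integrable M (\<lambda>\<omega>. \<bar>f \<omega>\<bar> powr enn2real p)}"

definition Lp_at ::
    "ennreal \<Rightarrow> 'a measure \<Rightarrow> (real \<Rightarrow> 'a measure) \<Rightarrow> real \<Rightarrow> ('a \<Rightarrow> real) \<Rightarrow> ('a \<Rightarrow> real) set" where
  "Lp_at p M F T \<tau> = Lp p M \<inter> borel_measurable (F_at M F T \<tau>)"

definition admissible_family ::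
    "'a measure \<Rightarrow> (real \<Rightarrow> 'a measure) \<Rightarrow> real \<Rightarrow> (nat \<Rightarrow> 'a \<Rightarrow> real) \<Rightarrow>
      (('a \<Rightarrow> real) \<Rightarrow> 'a \<Rightarrow> real) \<Rightarrow> bool" where
  "admissible_family M F T \<theta> \<phi> \<longleftrightarrow>
     (\<forall>\<tau>\<in>Theta M F T \<theta>. \<phi> \<tau> \<in> borel_measurable (F_at M F T \<tau>)) \<and>
     (\<forall>\<tau>\<in>Theta M F T \<theta>. \<forall>\<tau>'\<in>Theta M F T \<theta>. AE \<omega> in M. \<tau> \<omega> = \<tau>' \<omega> \<longrightarrow> \<phi> \<tau> \<omega> = \<phi> \<tau>' \<omega>)"

definition p_integrable_family ::
    "ennreal \<Rightarrow> 'a measure \<Rightarrow> (real \<Rightarrow> 'a measure) \<Rightarrow> real \<Rightarrow> (nat \<Rightarrow> 'a \<Rightarrow> real) \<Rightarrow>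
      (('a \<Rightarrow> real) \<Rightarrow> 'a \<Rightarrow> real) \<Rightarrow> bool" where
  "p_integrable_family p M F T \<theta> \<phi> \<longleftrightarrow> (\<forall>\<tau>\<in>Theta M F T \<theta>. \<phi> \<tau> \<in> Lp p M)"

section \<open>Families of operators\<close>

type_synonym 'a operators = "('a \<Rightarrow> real) \<Rightarrow> ('a \<Rightarrow> real) \<Rightarrow> ('a \<Rightarrow> real) \<Rightarrow> ('a \<Rightarrow> real)"

text \<open>The second conjunct makes \<open>\<rho> S \<tau>\<close> well defined on almost-sure equivalence classes.\<close>

definition operator_family ::
    "ennreal \<Rightarrow> 'a measure \<Rightarrow> (real \<Rightarrow> 'a measure) \<Rightarrow> real \<Rightarrow> (nat \<Rightarrow> 'a \<Rightarrow> real) \<Rightarrow> 'a operators \<Rightarrow> bool" where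
  "operator_family p M F T \<theta> \<rho> \<longleftrightarrow> (\<forall>S\<in>Theta M F T \<theta>. \<forall>\<tau>\<in>Theta M F T \<theta>.
     (\<forall>\<eta>\<in>Lp_at p M F T \<tau>. \<rho> S \<tau> \<eta> \<in> Lp_at p M F T S) \<and>
     (\<forall>\<eta>\<in>Lp_at p M F T \<tau>. \<forall>\<eta>'\<in>Lp_at p M F T \<tau>.
        (AE \<omega> in M. \<eta> \<omega> = \<eta>' \<omega>) \<longrightarrow> (AE \<omega> in M. \<rho> S \<tau> \<eta> \<omega> = \<rho> S \<tau> \<eta>' \<omega>)))"

definition op_admissible ::
    "ennreal \<Rightarrow> 'a measure \<Rightarrow> (real \<Rightarrow> 'a measure) \<Rightarrow> real \<Rightarrow> (nat \<Rightarrow> 'a \<Rightarrow> real) \<Rightarrow> 'a operators \<Rightarrow> bool" where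
  "op_admissible p M F T \<theta> \<rho> \<longleftrightarrow>
     (\<forall>S\<in>Theta M F T \<theta>. \<forall>S'\<in>Theta M F T \<theta>. \<forall>\<tau>\<in>Theta M F T \<theta>. \<forall>\<eta>\<in>Lp_at p M F T \<tau>.
        AE \<omega> in M. S \<omega> = S' \<omega> \<longrightarrow> \<rho> S \<tau> \<eta> \<omega> = \<rho> S' \<tau> \<eta> \<omega>)"

definition op_knowledge_preserving ::
    "ennreal \<Rightarrow> 'a measure \<Rightarrow> (real \<Rightarrow> 'a measure) \<Rightarrow> real \<Rightarrow> (nat \<Rightarrow> 'a \<Rightarrow> real) \<Rightarrow> 'a operators \<Rightarrow> bool" where
  "op_knowledge_preserving p M F T \<theta> \<rho> \<longleftrightarrow>
     (\<forall>S\<in>Theta M F T \<theta>. \<forall>\<tau>\<in>Theta_from M F T \<theta> S. \<forall>\<eta>\<in>Lp_at p M F T S.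
        AE \<omega> in M. \<rho> \<tau> S \<eta> \<omega> = \<eta> \<omega>)"

definition op_monotone ::
    "ennreal \<Rightarrow> 'a measure \<Rightarrow> (real \<Rightarrow> 'a measure) \<Rightarrow> real \<Rightarrow> (nat \<Rightarrow> 'a \<Rightarrow> real) \<Rightarrow> 'a operators \<Rightarrow> bool" where
  "op_monotone p M F T \<theta> \<rho> \<longleftrightarrow>
     (\<forall>S\<in>Theta M F T \<theta>. \<forall>\<tau>\<in>Theta M F T \<theta>. \<forall>\<eta>\<^sub>1\<in>Lp_at p M F T \<tau>. \<forall>\<eta>\<^sub>2\<in>Lp_at p M F T \<tau>.
        (AE \<omega> in M. \<eta>\<^sub>1 \<omega> \<le> \<eta>\<^sub>2 \<omega>) \<longrightarrow> (AE \<omega> in M. \<rho> S \<tau> \<eta>\<^sub>1 \<omega> \<le> \<rho> S \<tau> \<eta>\<^sub>2 \<omega>))"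

definition op_consistent ::
    "ennreal \<Rightarrow> 'a measure \<Rightarrow> (real \<Rightarrow> 'a measure) \<Rightarrow> real \<Rightarrow> (nat \<Rightarrow> 'a \<Rightarrow> real) \<Rightarrow> 'a operators \<Rightarrow> bool" where
  "op_consistent p M F T \<theta> \<rho> \<longleftrightarrow>
     (\<forall>S\<in>Theta M F T \<theta>. \<forall>\<sigma>\<in>Theta_from M F T \<theta> S. \<forall>\<tau>\<in>Theta_from M F T \<theta> \<sigma>. \<forall>\<eta>\<in>Lp_at p M F T \<tau>.
        AE \<omega> in M. \<rho> S \<sigma> (\<rho> \<sigma> \<tau> \<eta>) \<omega> = \<rho> S \<tau> \<eta> \<omega>)"

definition op_zero_one ::
    "ennreal \<Rightarrow> 'a measure \<Rightarrow> (real \<Rightarrow> 'a measure) \<Rightarrow> real \<Rightarrow> (nat \<Rightarrow> 'a \<Rightarrow> real) \<Rightarrow> 'a operators \<Rightarrow> bool" where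
  "op_zero_one p M F T \<theta> \<rho> \<longleftrightarrow>
     (\<forall>\<zeta>. admissible_family M F T \<theta> \<zeta> \<longrightarrow> p_integrable_family p M F T \<theta> \<zeta> \<longrightarrow>
       (\<forall>S\<in>Theta M F T \<theta>. \<forall>A\<in>sets (F_at M F T S).
        \<forall>\<tau>\<in>Theta_from M F T \<theta> S. \<forall>\<tau>'\<in>Theta_from M F T \<theta> S.
          (AE \<omega> in M. \<omega> \<in> A \<longrightarrow> \<tau> \<omega> = \<tau>' \<omega>) \<longrightarrow>
          (AE \<omega> in M. indicator A \<omega> * \<rho> S \<tau> (\<zeta> \<tau>) \<omega> = indicator A \<omega> * \<rho> S \<tau>' (\<zeta> \<tau>') \<omega>)))"

section \<open>Essential supremum and infimum of a family of random variables\<close>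

text \<open>The library's \<open>esssup\<close> is the essential supremum of a single function. Here \<open>\<Phi>\<close> is a
  possibly uncountable family of random variables with values in \<open>D\<close>, and its essential
  supremum is its least upper bound for the almost-sure order among \<open>D\<close>-valued random variables.
  It is unique up to null sets; \<open>SOME\<close> picks a version. With \<open>D = UNIV\<close> in the extended reals the
  value infinity is allowed; with \<open>D = {0..T}\<close> the version is everywhere a possible time.\<close>

definition is_ess_sup ::
    "'a measure \<Rightarrow> 'b::{order, topological_space} set \<Rightarrow> ('a \<Rightarrow> 'b) set \<Rightarrow> ('a \<Rightarrow> 'b) \<Rightarrow> bool" where
  "is_ess_sup M D \<Phi> Y \<longleftrightarrow> Y \<in> measurable M (restrict_space borel D) \<and>
     (\<forall>X\<in>\<Phi>. AE \<omega> in M. X \<omega> \<le> Y \<omega>) \<and>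
     (\<forall>Z\<in>measurable M (restrict_space borel D).
        (\<forall>X\<in>\<Phi>. AE \<omega> in M. X \<omega> \<le> Z \<omega>) \<longrightarrow> (AE \<omega> in M. Y \<omega> \<le> Z \<omega>))"

definition is_ess_inf ::
    "'a measure \<Rightarrow> 'b::{order, topological_space} set \<Rightarrow> ('a \<Rightarrow> 'b) set \<Rightarrow> ('a \<Rightarrow> 'b) \<Rightarrow> bool" where
  "is_ess_inf M D \<Phi> Y \<longleftrightarrow> Y \<in> measurable M (restrict_space borel D) \<and>
     (\<forall>X\<in>\<Phi>. AE \<omega> in M. Y \<omega> \<le> X \<omega>) \<and>
     (\<forall>Z\<in>measurable M (restrict_space borel D).
        (\<forall>X\<in>\<Phi>. AE \<omega> in M. Z \<omega> \<le> X \<omega>) \<longrightarrow> (AE \<omega> in M. Z \<omega> \<le> Y \<omega>))"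

definition ess_sup ::
    "'a measure \<Rightarrow> 'b::{order, topological_space} set \<Rightarrow> ('a \<Rightarrow> 'b) set \<Rightarrow> 'a \<Rightarrow> 'b" where
  "ess_sup M D \<Phi> = (SOME Y. is_ess_sup M D \<Phi> Y)"

definition ess_inf ::
    "'a measure \<Rightarrow> 'b::{order, topological_space} set \<Rightarrow> ('a \<Rightarrow> 'b) set \<Rightarrow> 'a \<Rightarrow> 'b" where
  "ess_inf M D \<Phi> = (SOME Y. is_ess_inf M D \<Phi> Y)"

section \<open>The families U and V and the associated times\<close>

text \<open>\<open>U_grid \<rho> \<theta> \<xi> n k\<close> is the random variable that backward induction assigns to \<open>\<theta> k\<close>,
  for \<open>k \<le> n\<close>.\<close>

function U_grid ::
    "'a operators \<Rightarrow> (nat \<Rightarrow> 'a \<Rightarrow> real) \<Rightarrow> (('a \<Rightarrow> real) \<Rightarrow> 'a \<Rightarrow> real) \<Rightarrow> nat \<Rightarrow> nat \<Rightarrow> 'a \<Rightarrow> real" where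
  "U_grid \<rho> \<theta> \<xi> n k =
     (if k < n then (\<lambda>\<omega>. max (\<xi> (\<theta> k) \<omega>) (\<rho> (\<theta> k) (\<theta> (Suc k)) (U_grid \<rho> \<theta> \<xi> n (Suc k)) \<omega>))
      else \<xi> (\<theta> n))"
  by auto
termination
  by (relation "Wellfounded.measure (\<lambda>(\<rho>, \<theta>, \<xi>, n, k). n - k)") auto

declare U_grid.simps [simp del]

definition grid_partition ::
    "'a measure \<Rightarrow> (real \<Rightarrow> 'a measure) \<Rightarrow> real \<Rightarrow> (nat \<Rightarrow> 'a \<Rightarrow> real) \<Rightarrow> nat \<Rightarrow>
      ('a \<Rightarrow> real) \<Rightarrow> (nat \<Rightarrow> 'a set) \<Rightarrow> bool" where
  "grid_partition M F T \<theta> n \<tau> A \<longleftrightarrow>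
     (\<forall>k\<le>n. A k \<in> sets (F_at M F T (\<theta> k))) \<and>
     disjoint_family_on A {..n} \<and> (\<Union>k\<le>n. A k) = space M \<and>
     (AE \<omega> in M. \<tau> \<omega> = (\<Sum>k\<le>n. \<theta> k \<omega> * indicator (A k) \<omega>))"

text \<open>Up to null sets \<open>U_fam\<close> does not depend on the partition that \<open>SOME\<close> picks.\<close>

definition U_fam ::
    "'a measure \<Rightarrow> (real \<Rightarrow> 'a measure) \<Rightarrow> real \<Rightarrow> (nat \<Rightarrow> 'a \<Rightarrow> real) \<Rightarrow> 'a operators \<Rightarrow>
      (('a \<Rightarrow> real) \<Rightarrow> 'a \<Rightarrow> real) \<Rightarrow> nat \<Rightarrow> ('a \<Rightarrow> real) \<Rightarrow> 'a \<Rightarrow> real" where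
  "U_fam M F T \<theta> \<rho> \<xi> n \<tau> = (let A = (SOME A. grid_partition M F T \<theta> n \<tau> A) in
     (\<lambda>\<omega>. \<Sum>k\<le>n. U_grid \<rho> \<theta> \<xi> n k \<omega> * indicator (A k) \<omega>))"

definition V_fam ::
    "'a measure \<Rightarrow> (real \<Rightarrow> 'a measure) \<Rightarrow> real \<Rightarrow> (nat \<Rightarrow> 'a \<Rightarrow> real) \<Rightarrow> 'a operators \<Rightarrow>
      (('a \<Rightarrow> real) \<Rightarrow> 'a \<Rightarrow> real) \<Rightarrow> ('a \<Rightarrow> real) \<Rightarrow> 'a \<Rightarrow> ereal" where
  "V_fam M F T \<theta> \<rho> \<xi> \<nu> =
     ess_sup M UNIV {(\<lambda>\<omega>. ereal (\<rho> \<nu> \<tau> (\<xi> \<tau>) \<omega>)) |\<tau>. \<tau> \<in> Theta_from M F T \<theta> \<nu>}"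

definition nu_bar ::
    "'a measure \<Rightarrow> (real \<Rightarrow> 'a measure) \<Rightarrow> real \<Rightarrow> (nat \<Rightarrow> 'a \<Rightarrow> real) \<Rightarrow> 'a operators \<Rightarrow>
      (('a \<Rightarrow> real) \<Rightarrow> 'a \<Rightarrow> real) \<Rightarrow> nat \<Rightarrow> nat \<Rightarrow> 'a \<Rightarrow> real" where
  "nu_bar M F T \<theta> \<rho> \<xi> n k = ess_inf M {0..T}
     {\<tau> \<in> Theta_from M F T \<theta> (\<theta> k). AE \<omega> in M. U_fam M F T \<theta> \<rho> \<xi> n \<tau> \<omega> = \<xi> \<tau> \<omega>}"

definition nu ::
    "'a measure \<Rightarrow> (real \<Rightarrow> 'a measure) \<Rightarrow> real \<Rightarrow> (nat \<Rightarrow> 'a \<Rightarrow> real) \<Rightarrow> 'a operators \<Rightarrow>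
      (('a \<Rightarrow> real) \<Rightarrow> 'a \<Rightarrow> real) \<Rightarrow> nat \<Rightarrow> 'a \<Rightarrow> real" where
  "nu M F T \<theta> \<rho> \<xi> k = ess_inf M {0..T}
     {\<tau> \<in> Theta_from M F T \<theta> (\<theta> k). AE \<omega> in M. V_fam M F T \<theta> \<rho> \<xi> \<tau> \<omega> = ereal (\<xi> \<tau> \<omega>)}"

end

theory Submission
  imports Defs
begin

text \<open>Up to null sets, the elements of \<open>Theta\<close> are the stopping times with values on the finite
  grid, so \<open>Theta\<close> is closed under maxima and under pasting along sets known at the earlier time.
  Backward induction over the grid shows that \<open>U (\<theta> k)\<close> dominates every reward
  \<open>\<rho> (\<theta> k) \<tau> (\<xi> \<tau>)\<close> and is the reward of the first grid time after \<open>\<theta> k\<close> where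
  \<open>U\<close> meets \<open>\<xi>\<close>: the zero-one law separates stopping at \<open>\<theta> k\<close> from continuing to
  \<open>\<theta> (Suc k)\<close>, and consistency reduces the latter to the next step. That first hitting time is
  the least stopping time at which \<open>U\<close> and \<open>\<xi>\<close> agree, hence a version of the essential infimum.
  A general \<open>\<nu>\<close> is treated on each set \<open>\<nu> = \<theta> k\<close> separately.\<close>

section \<open>Essential bounds and the Lebesgue spaces\<close>

lemma is_ess_sup_unique:
  assumes "is_ess_sup M D \<Phi> Y" "is_ess_sup M D \<Phi> Z"
  shows "AE \<omega> in M. Y \<omega> = Z \<omega>"
proof -
  have "AE \<omega> in M. Y \<omega> \<le> Z \<omega>" "AE \<omega> in M. Z \<omega> \<le> Y \<omega>"
    using assms unfolding is_ess_sup_def by blast+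
  then show ?thesis by eventually_elim (rule antisym)
qed

lemma is_ess_inf_unique:
  assumes "is_ess_inf M D \<Phi> Y" "is_ess_inf M D \<Phi> Z"
  shows "AE \<omega> in M. Y \<omega> = Z \<omega>"
proof -
  have "AE \<omega> in M. Y \<omega> \<le> Z \<omega>" "AE \<omega> in M. Z \<omega> \<le> Y \<omega>"
    using assms unfolding is_ess_inf_def by blast+
  then show ?thesis by eventually_elim (rule antisym)
qed

text \<open>Choice yields an essential supremum as soon as one exists. Existence is not derived from
  general principles: for each family at hand an explicit version serves as
  \<open>Y\<close>.\<close>

lemma is_ess_sup_ess_sup: "is_ess_sup M D \<Phi> Y \<Longrightarrow> is_ess_sup M D \<Phi> (ess_sup M D \<Phi>)"
  unfolding ess_sup_def by (rule someI[where P="is_ess_sup M D \<Phi>"])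

lemma is_ess_inf_ess_inf: "is_ess_inf M D \<Phi> Y \<Longrightarrow> is_ess_inf M D \<Phi> (ess_inf M D \<Phi>)"
  unfolding ess_inf_def by (rule someI[where P="is_ess_inf M D \<Phi>"])

text \<open>For \<open>p = \<top>\<close> the larger of the two essential bounds works. Otherwise
  the power of the maximum is one of the two powers, hence at most their sum.\<close>

lemma Lp_max:
  assumes f: "f \<in> Lp p M" and g: "g \<in> Lp p M"
  shows "(\<lambda>\<omega>. max (f \<omega>) (g \<omega>)) \<in> Lp p M"
proof -
  have [measurable]: "f \<in> borel_measurable M" "g \<in> borel_measurable M"
    using f g by (auto simp: Lp_def)
  show ?thesis
  proof (cases "p = \<top>")
    case True
    have "AE \<omega> in M. ereal \<bar>f \<omega>\<bar> \<le> esssup M (\<lambda>\<omega>. ereal \<bar>f \<omega>\<bar>)"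
      "AE \<omega> in M. ereal \<bar>g \<omega>\<bar> \<le> esssup M (\<lambda>\<omega>. ereal \<bar>g \<omega>\<bar>)"
      by (rule esssup_AE)+
    then have "AE \<omega> in M. ereal \<bar>max (f \<omega>) (g \<omega>)\<bar>
        \<le> max (esssup M (\<lambda>\<omega>. ereal \<bar>f \<omega>\<bar>)) (esssup M (\<lambda>\<omega>. ereal \<bar>g \<omega>\<bar>))"
      by eventually_elim (auto simp: max_def intro: order_trans)
    then have "esssup M (\<lambda>\<omega>. ereal \<bar>max (f \<omega>) (g \<omega>)\<bar>)
        \<le> max (esssup M (\<lambda>\<omega>. ereal \<bar>f \<omega>\<bar>)) (esssup M (\<lambda>\<omega>. ereal \<bar>g \<omega>\<bar>))"
      by (intro esssup_I) auto
    moreover have "\<dots> < \<infinity>"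
      using f g True by (simp add: Lp_def max_def)
    ultimately show ?thesis
      using True by (auto simp: Lp_def intro: le_less_trans)
  next
    case False
    have "integrable M (\<lambda>\<omega>. \<bar>f \<omega>\<bar> powr enn2real p + \<bar>g \<omega>\<bar> powr enn2real p)"
      using f g False by (auto simp: Lp_def)
    then have "integrable M (\<lambda>\<omega>. \<bar>max (f \<omega>) (g \<omega>)\<bar> powr enn2real p)"
      by (rule Bochner_Integration.integrable_bound) (auto simp: max_def)
    with False show ?thesis by (simp add: Lp_def)
  qed
qed

section \<open>Stopping times of a complete filtration\<close>

context stopping_grid
begin

abbreviation ST :: "('a \<Rightarrow> real) set" where
  "ST \<equiv> stopping_times M F T"

abbreviation Th :: "('a \<Rightarrow> real) set" where
  "Th \<equiv> Theta M F T \<theta>"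

abbreviation Th_from :: "('a \<Rightarrow> real) \<Rightarrow> ('a \<Rightarrow> real) set" where
  "Th_from \<equiv> Theta_from M F T \<theta>"

abbreviation Fsets :: "('a \<Rightarrow> real) \<Rightarrow> 'a set set" where
  "Fsets \<tau> \<equiv> sets (F_at M F T \<tau>)"

lemma space_frozen: "space (frozen T F t) = space M"
  using F_subalgebra[of "max 0 (min T t)"] T_pos by (simp add: frozen_def subalgebra_def)

lemma sets_frozen: "sets (frozen T F t) \<subseteq> sets M"
  using F_subalgebra[of "max 0 (min T t)"] T_pos by (simp add: frozen_def subalgebra_def)

text \<open>Clamping the index to the interval preserves the order, so monotonicity of
  \<open>F\<close> on \<open>{0..T}\<close> gives a filtration over all reals, to which the library
  notions apply.\<close>

sublocale frozen: filtration "space M" "frozen T F"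
proof
  show "space (frozen T F i) = space M" for i by (rule space_frozen)
  show "sets (frozen T F i) \<le> sets (frozen T F j)" if "i \<le> j" for i j
    unfolding frozen_def using that T_pos by (intro F_mono) auto
qed

lemma null_set_frozen: "A \<in> null_sets M \<Longrightarrow> A \<in> sets (frozen T F t)"
  using F_complete F_mono[of 0 "max 0 (min T t)"] T_pos by (auto simp: frozen_def)

text \<open>\<open>A\<close> and \<open>B\<close> differ by two sets that vanish almost surely.
  Completeness of \<open>M\<close> makes these measurable null sets, although \<open>B\<close> is
  arbitrary, and \<open>F_complete\<close> puts them into every member of the filtration.\<close>

lemma sets_frozen_AE_cong:
  assumes A: "A \<in> sets (frozen T F t)" and B: "B \<subseteq> space M"
    and AB: "AE \<omega> in M. \<omega> \<in> B \<longleftrightarrow> \<omega> \<in> A"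
  shows "B \<in> sets (frozen T F t)"
proof -
  have AM: "A \<subseteq> space M" using A sets_frozen sets.sets_into_space by blast
  have "AE \<omega> in M. \<omega> \<notin> B - A" "AE \<omega> in M. \<omega> \<notin> A - B"
    using AB by (eventually_elim, blast)+
  then have "B - A \<in> null_sets M" "A - B \<in> null_sets M"
    using AM B by (auto simp: null_sets_iff_AE)
  then have "(A - (A - B)) \<union> (B - A) \<in> sets (frozen T F t)"
    using A null_set_frozen by blast
  also have "(A - (A - B)) \<union> (B - A) = B" by blast
  finally show ?thesis .
qed

lemma ST_stopping: "\<tau> \<in> ST \<Longrightarrow> stopping_time (frozen T F) \<tau>"
  by (simp add: stopping_times_def)

lemma ST_range: "\<tau> \<in> ST \<Longrightarrow> \<omega> \<in> space M \<Longrightarrow> \<tau> \<omega> \<in> {0..T}"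
  by (auto simp: stopping_times_def)

lemma ST_sets: "\<tau> \<in> ST \<Longrightarrow> {\<omega>\<in>space M. \<tau> \<omega> \<le> t} \<in> sets (frozen T F t)"
  using stopping_timeD[OF ST_stopping, of \<tau> t] by (simp add: pred_def space_frozen)

lemma STI:
  assumes "\<And>\<omega>. \<omega> \<in> space M \<Longrightarrow> \<tau> \<omega> \<in> {0..T}"
    and "\<And>t. {\<omega>\<in>space M. \<tau> \<omega> \<le> t} \<in> sets (frozen T F t)"
  shows "\<tau> \<in> ST"
  using assms by (auto simp: stopping_times_def stopping_time_def pred_def space_frozen)

text \<open>The target space is the one that \<open>is_ess_inf\<close> demands for
  \<open>D = {0..T}\<close>.\<close>

lemma ST_measurable:
  assumes "\<tau> \<in> ST" shows "\<tau> \<in> measurable M (restrict_space borel {0..T})"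
  using measurable_stopping_time[OF ST_stopping[OF assms] sets_frozen space_frozen] ST_range[OF assms]
  by (intro measurable_restrict_space2) auto

section \<open>Events known at a stopping time\<close>

lemma Fsets_iff:
  "\<tau> \<in> ST \<Longrightarrow> A \<in> Fsets \<tau> \<longleftrightarrow> (\<forall>t. {\<omega>\<in>A. \<tau> \<omega> \<le> t} \<in> sets (frozen T F t))"
  unfolding F_at_def by (simp add: frozen.sets_pre_sigma ST_stopping)

lemma space_F_at: "space (F_at M F T \<tau>) = space M"
  by (simp add: F_at_def frozen.space_pre_sigma)

lemma Fsets_space: "space M \<in> Fsets \<tau>"
  using sets.top[of "F_at M F T \<tau>"] by (simp add: space_F_at)

lemma Fsets_subset: "A \<in> Fsets \<tau> \<Longrightarrow> A \<subseteq> space M"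
  using sets.sets_into_space[of A "F_at M F T \<tau>"] by (simp add: space_F_at)

lemma Fsets_less: "\<sigma> \<in> ST \<Longrightarrow> \<tau> \<in> ST \<Longrightarrow> {\<omega>\<in>space M. \<sigma> \<omega> < \<tau> \<omega>} \<in> Fsets \<sigma>"
  using frozen.stopping_time_less[OF ST_stopping ST_stopping, of \<sigma> \<tau>]
  by (simp add: F_at_def pred_def frozen.space_pre_sigma)

lemma Fsets_ge: "\<sigma> \<in> ST \<Longrightarrow> \<tau> \<in> ST \<Longrightarrow> {\<omega>\<in>space M. \<sigma> \<omega> \<le> \<tau> \<omega>} \<in> Fsets \<tau>"
proof -
  assume "\<sigma> \<in> ST" "\<tau> \<in> ST"
  then have "space M - {\<omega>\<in>space M. \<tau> \<omega> < \<sigma> \<omega>} \<in> Fsets \<tau>"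
    by (intro sets.Diff Fsets_less Fsets_space)
  also have "space M - {\<omega>\<in>space M. \<tau> \<omega> < \<sigma> \<omega>} = {\<omega>\<in>space M. \<sigma> \<omega> \<le> \<tau> \<omega>}" by auto
  finally show ?thesis .
qed

text \<open>On \<open>{\<tau> \<le> t}\<close> the condition \<sigma> \<le> \<tau> forces \<sigma>
  \<le> t. So cutting \<open>B\<close> at t gives, up to a null set, the intersection of
  \<open>A\<close> cut by \<sigma> \<le> t with the event \<sigma> \<le> \<tau> cut by \<tau> \<le>
  t, and both are known at t. The almost-sure form covers times that are ordered only almost
  surely.\<close>

lemma Fsets_transfer:
  assumes \<sigma>: "\<sigma> \<in> ST" and \<tau>: "\<tau> \<in> ST" and A: "A \<in> Fsets \<sigma>" and B: "B \<subseteq> space M"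
    and AB: "AE \<omega> in M. \<omega> \<in> B \<longleftrightarrow> \<omega> \<in> A \<and> \<sigma> \<omega> \<le> \<tau> \<omega>"
  shows "B \<in> Fsets \<tau>"
  unfolding Fsets_iff[OF \<tau>]
proof
  fix t
  have "{\<omega>\<in>A. \<sigma> \<omega> \<le> t} \<inter> {\<omega>\<in>{\<omega>\<in>space M. \<sigma> \<omega> \<le> \<tau> \<omega>}. \<tau> \<omega> \<le> t} \<in> sets (frozen T F t)"
    using A Fsets_ge[OF \<sigma> \<tau>] unfolding Fsets_iff[OF \<sigma>] Fsets_iff[OF \<tau>] by blast
  moreover have "AE \<omega> in M. \<omega> \<in> {\<omega>\<in>B. \<tau> \<omega> \<le> t} \<longleftrightarrow>
      \<omega> \<in> {\<omega>\<in>A. \<sigma> \<omega> \<le> t} \<inter> {\<omega>\<in>{\<omega>\<in>space M. \<sigma> \<omega> \<le> \<tau> \<omega>}. \<tau> \<omega> \<le> t}"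
    using AB AE_space by eventually_elim auto
  moreover have "{\<omega>\<in>B. \<tau> \<omega> \<le> t} \<subseteq> space M" using B by auto
  ultimately show "{\<omega>\<in>B. \<tau> \<omega> \<le> t} \<in> sets (frozen T F t)"
    using sets_frozen_AE_cong by blast
qed

lemma Fsets_mono:
  assumes "\<sigma> \<in> ST" "\<tau> \<in> ST" "AE \<omega> in M. \<sigma> \<omega> \<le> \<tau> \<omega>" "A \<in> Fsets \<sigma>"
  shows "A \<in> Fsets \<tau>"
  using assms(1,2,4) Fsets_subset[OF assms(4)]
  by (rule Fsets_transfer) (use assms(3) in eventually_elim, auto)

lemma Fsets_eq:
  assumes "\<sigma> \<in> ST" "\<tau> \<in> ST"
  shows "{\<omega>\<in>space M. \<sigma> \<omega> = \<tau> \<omega>} \<in> Fsets \<tau>"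
proof -
  \<comment> \<open>\<open>Fsets_less\<close> places this event in the past of \<sigma>; as it lies
    inside \<sigma> \<le> \<tau>, it passes to the past of \<tau>.\<close>
  have "{\<omega>\<in>space M. \<sigma> \<omega> < \<tau> \<omega>} \<in> Fsets \<tau>"
    by (rule Fsets_transfer[OF assms Fsets_less[OF assms]]) auto
  then have "{\<omega>\<in>space M. \<sigma> \<omega> \<le> \<tau> \<omega>} - {\<omega>\<in>space M. \<sigma> \<omega> < \<tau> \<omega>} \<in> Fsets \<tau>"
    by (intro sets.Diff Fsets_ge assms)
  also have "{\<omega>\<in>space M. \<sigma> \<omega> \<le> \<tau> \<omega>} - {\<omega>\<in>space M. \<sigma> \<omega> < \<tau> \<omega>} = {\<omega>\<in>space M. \<sigma> \<omega> = \<tau> \<omega>}"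
    by auto
  finally show ?thesis .
qed

section \<open>Stopping times under null modifications, pasting and maxima\<close>

lemma ST_AE_cong:
  assumes \<tau>: "\<tau> \<in> ST" and \<sigma>: "\<And>\<omega>. \<omega> \<in> space M \<Longrightarrow> \<sigma> \<omega> \<in> {0..T}" and eq: "AE \<omega> in M. \<sigma> \<omega> = \<tau> \<omega>"
  shows "\<sigma> \<in> ST"
proof (rule STI[OF \<sigma>])
  show "{\<omega>\<in>space M. \<sigma> \<omega> \<le> t} \<in> sets (frozen T F t)" for t
    by (rule sets_frozen_AE_cong[OF ST_sets[OF \<tau>]]) (use eq in \<open>auto elim: eventually_mono\<close>)
qed

text \<open>The decision \<open>B\<close> is taken at the earlier time, so the complement of
  \<open>B\<close> is still known at \<tau>. Each branch then contributes an event known at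
  t.\<close>

lemma ST_If:
  assumes \<sigma>: "\<sigma> \<in> ST" and \<tau>: "\<tau> \<in> ST" and le: "AE \<omega> in M. \<sigma> \<omega> \<le> \<tau> \<omega>" and B: "B \<in> Fsets \<sigma>"
  shows "(\<lambda>\<omega>. if \<omega> \<in> B then \<sigma> \<omega> else \<tau> \<omega>) \<in> ST"
proof (rule STI)
  show "(if \<omega> \<in> B then \<sigma> \<omega> else \<tau> \<omega>) \<in> {0..T}" if "\<omega> \<in> space M" for \<omega>
    using ST_range[OF \<sigma> that] ST_range[OF \<tau> that] by simp
  fix t
  have "space M - B \<in> Fsets \<tau>"
    by (rule Fsets_mono[OF \<sigma> \<tau> le]) (use B Fsets_space in auto)
  then have "{\<omega>\<in>B. \<sigma> \<omega> \<le> t} \<union> {\<omega>\<in>space M - B. \<tau> \<omega> \<le> t} \<in> sets (frozen T F t)"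
    using B by (auto simp: Fsets_iff \<sigma> \<tau>)
  also have "{\<omega>\<in>B. \<sigma> \<omega> \<le> t} \<union> {\<omega>\<in>space M - B. \<tau> \<omega> \<le> t}
      = {\<omega>\<in>space M. (if \<omega> \<in> B then \<sigma> \<omega> else \<tau> \<omega>) \<le> t}"
    using Fsets_subset[OF B] by auto
  finally show "{\<omega>\<in>space M. (if \<omega> \<in> B then \<sigma> \<omega> else \<tau> \<omega>) \<le> t} \<in> sets (frozen T F t)" .
qed

lemma ST_max:
  assumes \<sigma>: "\<sigma> \<in> ST" and \<tau>: "\<tau> \<in> ST"
  shows "(\<lambda>\<omega>. max (\<sigma> \<omega>) (\<tau> \<omega>)) \<in> ST"
proof -
  have "max (\<sigma> \<omega>) (\<tau> \<omega>) \<in> {0..T}" if "\<omega> \<in> space M" for \<omega>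
    using ST_range[OF \<sigma> that] ST_range[OF \<tau> that] by auto
  then show ?thesis
    using stopping_time_max[OF ST_stopping[OF \<sigma>] ST_stopping[OF \<tau>]] by (simp add: stopping_times_def)
qed

lemma theta_mono_AE: "AE \<omega> in M. \<forall>i j. i \<le> j \<longrightarrow> \<theta> i \<omega> \<le> \<theta> j \<omega>"
proof -
  have "AE \<omega> in M. \<forall>k. \<theta> k \<omega> \<le> \<theta> (Suc k) \<omega>"
    using theta_mono by (simp add: AE_all_countable)
  then show ?thesis
    by eventually_elim (blast intro: lift_Suc_mono_le[where f="\<lambda>k. \<theta> k _"])
qed

end

section \<open>Grids that reach the horizon after finitely many steps\<close>

lemma sum_indicator_single:
  fixes f :: "nat \<Rightarrow> real"
  assumes "disjoint_family_on A {..n}" "k \<le> n" "\<omega> \<in> A k"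
  shows "(\<Sum>j\<le>n. f j * indicator (A j) \<omega>) = f k"
proof -
  have "f j * indicator (A j) \<omega> = (if j = k then f k else 0)" if "j \<le> n" for j
    using assms that by (auto simp: disjoint_family_on_def indicator_def)
  then have "(\<Sum>j\<le>n. f j * indicator (A j) \<omega>) = (\<Sum>j\<le>n. if j = k then f k else 0)"
    by (intro sum.cong) auto
  then show ?thesis using assms(2) by simp
qed

locale finite_grid = stopping_grid +
  fixes n :: nat
  assumes theta_end: "\<And>m. n \<le> m \<Longrightarrow> AE \<omega> in M. \<theta> m \<omega> = T"
begin

text \<open>All cells with index beyond \<open>n\<close>, and the cell \<open>B\<close> as well,
  carry the value \<open>T\<close>, which is already the value of \<open>\<theta> n\<close>.\<close>

lemma Theta_on_grid:
  assumes "\<tau> \<in> Th"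
  shows "AE \<omega> in M. \<exists>k\<le>n. \<tau> \<omega> = \<theta> k \<omega>"
proof -
  from assms obtain A B where disj: "disjoint_family A" "\<forall>k. A k \<inter> B = {}"
    and un: "(\<Union>k. A k) \<union> B = space M"
    and \<tau>: "AE \<omega> in M. \<tau> \<omega> = (\<Sum>k. \<theta> k \<omega> * indicator (A k) \<omega>) + T * indicator B \<omega>"
    unfolding Theta_def by blast
  have "AE \<omega> in M. \<forall>m\<ge>n. \<theta> m \<omega> = T"
    using theta_end by (auto simp: AE_all_countable)
  with \<tau> AE_space show ?thesis
  proof eventually_elim
    case (elim \<omega>)
    consider k where "\<omega> \<in> A k" | "\<omega> \<in> B" using un elim(2) by blast
    then show ?case
    proof cases
      case 1
      have "\<omega> \<notin> A j" if "j \<noteq> k" for j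
        using disj(1) 1 that by (auto simp: disjoint_family_on_def)
      then have "(\<Sum>j. \<theta> j \<omega> * indicator (A j) \<omega>) = (\<Sum>j\<in>{k}. \<theta> j \<omega> * indicator (A j) \<omega>)"
        by (intro suminf_finite) auto
      moreover have "\<omega> \<notin> B" using 1 disj(2) by blast
      ultimately have "\<tau> \<omega> = \<theta> k \<omega>" using elim(1) 1 by simp
      then show ?thesis
        using elim(3) by (metis linorder_le_cases order_refl)
    next
      case 2
      then have "\<omega> \<notin> A j" for j using disj(2) by blast
      then have "\<tau> \<omega> = T" using elim(1) 2 by simp
      with elim(3) show ?thesis by auto
    qed
  qed
qed

text \<open>The last cell takes the null set where the values of \<open>\<tau>\<close> are off the grid.\<close>

lemma grid_partition_exists:
  assumes \<tau>: "\<tau> \<in> ST" and grid: "AE \<omega> in M. \<exists>k\<le>n. \<tau> \<omega> = \<theta> k \<omega>"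
  shows "\<exists>A. grid_partition M F T \<theta> n \<tau> A"
proof -
  define E where "E k = {\<omega>\<in>space M. \<tau> \<omega> = \<theta> k \<omega>}" for k
  define A where "A k = (if k < n then E k else space M) - (\<Union>i<k. E i)" for k
  have E: "E i \<in> Fsets (\<theta> k)" if "i \<le> k" for i k
  proof (rule Fsets_mono[OF theta_stopping theta_stopping])
    show "AE \<omega> in M. \<theta> i \<omega> \<le> \<theta> k \<omega>" using theta_mono_AE that by auto
    show "E i \<in> Fsets (\<theta> i)" unfolding E_def by (rule Fsets_eq[OF \<tau> theta_stopping])
  qed
  have "A k \<in> Fsets (\<theta> k)" for k
    unfolding A_def by (intro sets.Diff sets.finite_UN) (auto intro: E Fsets_space)
  moreover have disj: "disjoint_family_on A {..n}"
  proof -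
    have "A i \<inter> A j = {}" if "i < j" "j \<le> n" for i j
      using that by (auto simp: A_def)
    then show ?thesis
      unfolding disjoint_family_on_def by (metis atMost_iff inf_commute linorder_neqE_nat)
  qed
  moreover have un: "(\<Union>k\<le>n. A k) = space M"
  proof
    show "(\<Union>k\<le>n. A k) \<subseteq> space M" by (auto simp: A_def E_def split: if_splits)
    show "space M \<subseteq> (\<Union>k\<le>n. A k)"
    proof
      fix \<omega> assume \<omega>: "\<omega> \<in> space M"
      \<comment> \<open>The alternative \<open>k = n\<close> ensures that a least index exists even
        where \<tau> is off the grid.\<close>
      define k where "k = (LEAST k. k = n \<or> \<omega> \<in> E k)"
      have "k = n \<or> \<omega> \<in> E k" unfolding k_def by (rule LeastI[of _ n]) simp
      moreover have "k \<le> n" unfolding k_def by (rule Least_le) simp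
      moreover have "\<omega> \<notin> E i" if "i < k" for i
        using not_less_Least that unfolding k_def by blast
      ultimately show "\<omega> \<in> (\<Union>k\<le>n. A k)"
        using \<omega> by (intro UN_I[of k]) (auto simp: A_def)
    qed
  qed
  moreover have "AE \<omega> in M. \<tau> \<omega> = (\<Sum>k\<le>n. \<theta> k \<omega> * indicator (A k) \<omega>)"
    using grid AE_space
  proof eventually_elim
    case (elim \<omega>)
    then obtain k where k: "k \<le> n" "\<omega> \<in> A k" using un by blast
    have "\<tau> \<omega> = \<theta> k \<omega>"
    proof (cases "k < n")
      case True
      then show ?thesis using k by (simp add: A_def E_def)
    next
      case False
      \<comment> \<open>Here k is \<open>n\<close>. The sets \<open>E i\<close> with i < n have been
        removed from the last cell, so the grid index j can only be \<open>n\<close>.\<close>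
      obtain j where "j \<le> n" "\<tau> \<omega> = \<theta> j \<omega>" using elim by blast
      then show ?thesis using False k elim by (cases "j < k") (auto simp: A_def E_def)
    qed
    then show ?case using sum_indicator_single[OF disj k] by simp
  qed
  ultimately show ?thesis unfolding grid_partition_def by blast
qed

text \<open>For the converse, the finite partition is padded with empty cells and the exceptional
  cell \<open>B\<close> is empty. Membership in \<open>Theta\<close> can from here on be checked
  without constructing partitions.\<close>

lemma Theta_iff: "\<tau> \<in> Th \<longleftrightarrow> \<tau> \<in> ST \<and> (AE \<omega> in M. \<exists>k\<le>n. \<tau> \<omega> = \<theta> k \<omega>)"
proof
  show "\<tau> \<in> Th \<Longrightarrow> \<tau> \<in> ST \<and> (AE \<omega> in M. \<exists>k\<le>n. \<tau> \<omega> = \<theta> k \<omega>)"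
    using Theta_on_grid by (auto simp: Theta_def)
  assume *: "\<tau> \<in> ST \<and> (AE \<omega> in M. \<exists>k\<le>n. \<tau> \<omega> = \<theta> k \<omega>)"
  then obtain A where A: "grid_partition M F T \<theta> n \<tau> A"
    using grid_partition_exists by blast
  define A' where "A' k = (if k \<le> n then A k else {})" for k
  have sets: "\<forall>k. A' k \<in> Fsets (\<theta> k)" and disj: "disjoint_family A'" and un: "(\<Union>k. A' k) \<union> {} = space M"
    using A by (auto simp: grid_partition_def A'_def disjoint_family_on_def split: if_splits)
  have "(\<Sum>k. \<theta> k \<omega> * indicator (A' k) \<omega>) = (\<Sum>k\<le>n. \<theta> k \<omega> * indicator (A k) \<omega>)" for \<omega>
    by (subst suminf_finite[of "{..n}"]) (auto simp: A'_def)
  then have "AE \<omega> in M. \<tau> \<omega> = (\<Sum>k. \<theta> k \<omega> * indicator (A' k) \<omega>) + T * indicator {} \<omega>"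
    using A by (simp add: grid_partition_def)
  then show "\<tau> \<in> Th"
    unfolding Theta_def using * sets disj un by (intro CollectI conjI exI[of _ A'] exI[of _ "{}"]) auto
qed

section \<open>Closure properties of \<open>Theta\<close>\<close>

lemma Th_ST: "\<tau> \<in> Th \<Longrightarrow> \<tau> \<in> ST"
  by (simp add: Theta_iff)

lemma theta_Th: "k \<le> n \<Longrightarrow> \<theta> k \<in> Th"
  by (auto simp: Theta_iff theta_stopping)

lemma Th_from_self: "\<tau> \<in> Th \<Longrightarrow> \<tau> \<in> Th_from \<tau>"
  by (simp add: Theta_from_def)

lemma Th_from_Th: "\<tau> \<in> Th_from \<sigma> \<Longrightarrow> \<tau> \<in> Th"
  by (simp add: Theta_from_def)

lemma Th_from_le: "\<tau> \<in> Th_from \<sigma> \<Longrightarrow> AE \<omega> in M. \<sigma> \<omega> \<le> \<tau> \<omega>"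
  by (simp add: Theta_from_def)

lemma Th_from_mono:
  assumes "AE \<omega> in M. \<sigma> \<omega> \<le> \<sigma>' \<omega>" "\<tau> \<in> Th_from \<sigma>'"
  shows "\<tau> \<in> Th_from \<sigma>"
  using assms unfolding Theta_from_def by (auto elim: eventually_elim2)

lemma Th_max:
  assumes "\<sigma> \<in> Th" "\<tau> \<in> Th"
  shows "(\<lambda>\<omega>. max (\<sigma> \<omega>) (\<tau> \<omega>)) \<in> Th"
  unfolding Theta_iff
proof
  show "AE \<omega> in M. \<exists>k\<le>n. max (\<sigma> \<omega>) (\<tau> \<omega>) = \<theta> k \<omega>"
    using Theta_on_grid[OF assms(1)] Theta_on_grid[OF assms(2)]
    by eventually_elim (auto simp: max_def)
qed (use assms in \<open>auto simp: Theta_iff intro: ST_max\<close>)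

text \<open>A maximum moves a time beyond another one and leaves it unchanged where it already lies
  there. This supplies the global order that consistency and the zero-one law require when the order
  is known only on an event.\<close>

lemma Th_max_from:
  assumes "\<sigma> \<in> Th" "\<tau> \<in> Th"
  shows "(\<lambda>\<omega>. max (\<sigma> \<omega>) (\<tau> \<omega>)) \<in> Th_from \<sigma>" "(\<lambda>\<omega>. max (\<sigma> \<omega>) (\<tau> \<omega>)) \<in> Th_from \<tau>"
  using Th_max[OF assms] by (auto simp: Theta_from_def)

text \<open>This serves for the version of an essential infimum that \<open>SOME\<close> picks,
  which is known only up to null sets. The range condition holds everywhere because
  \<open>stopping_times\<close> imposes it everywhere.\<close>

lemma Th_AE_cong:
  assumes \<tau>: "\<tau> \<in> Th" and \<sigma>: "\<And>\<omega>. \<omega> \<in> space M \<Longrightarrow> \<sigma> \<omega> \<in> {0..T}" and eq: "AE \<omega> in M. \<sigma> \<omega> = \<tau> \<omega>"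
  shows "\<sigma> \<in> Th"
  unfolding Theta_iff
proof
  show "\<sigma> \<in> ST" by (rule ST_AE_cong[OF Th_ST[OF \<tau>] \<sigma> eq])
  show "AE \<omega> in M. \<exists>k\<le>n. \<sigma> \<omega> = \<theta> k \<omega>"
    using eq Theta_on_grid[OF \<tau>] by eventually_elim auto
qed

end

section \<open>Optimal stopping\<close>

locale optimal_stopping = finite_grid M F T \<theta> n
  for M :: "'a measure" and F T \<theta> n +
  fixes p :: ennreal and \<rho> :: "'a operators" and \<xi> :: "('a \<Rightarrow> real) \<Rightarrow> 'a \<Rightarrow> real"
  assumes xi_admissible: "admissible_family M F T \<theta> \<xi>"
    and xi_integrable: "p_integrable_family p M F T \<theta> \<xi>"
    and rho_family: "operator_family p M F T \<theta> \<rho>"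
    and rho_admissible: "op_admissible p M F T \<theta> \<rho>"
    and rho_knowledge: "op_knowledge_preserving p M F T \<theta> \<rho>"
    and rho_monotone: "op_monotone p M F T \<theta> \<rho>"
    and rho_consistent: "op_consistent p M F T \<theta> \<rho>"
    and rho_zero_one: "op_zero_one p M F T \<theta> \<rho>"
begin

abbreviation Ug :: "nat \<Rightarrow> 'a \<Rightarrow> real" where
  "Ug \<equiv> U_grid \<rho> \<theta> \<xi> n"

abbreviation U :: "('a \<Rightarrow> real) \<Rightarrow> 'a \<Rightarrow> real" where
  "U \<equiv> U_fam M F T \<theta> \<rho> \<xi> n"

abbreviation V :: "('a \<Rightarrow> real) \<Rightarrow> 'a \<Rightarrow> ereal" where
  "V \<equiv> V_fam M F T \<theta> \<rho> \<xi>"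

section \<open>The backward recursion and the operator properties in usable form\<close>

lemma Ug_end: "Ug n = \<xi> (\<theta> n)"
  by (simp add: U_grid.simps)

lemma Ug_step: "k < n \<Longrightarrow> Ug k = (\<lambda>\<omega>. max (\<xi> (\<theta> k) \<omega>) (\<rho> (\<theta> k) (\<theta> (Suc k)) (Ug (Suc k)) \<omega>))"
  by (subst U_grid.simps) simp

lemma xi_cong: "\<sigma> \<in> Th \<Longrightarrow> \<tau> \<in> Th \<Longrightarrow> AE \<omega> in M. \<sigma> \<omega> = \<tau> \<omega> \<longrightarrow> \<xi> \<sigma> \<omega> = \<xi> \<tau> \<omega>"
  using xi_admissible by (simp add: admissible_family_def)

lemma xi_Lp: "\<tau> \<in> Th \<Longrightarrow> \<xi> \<tau> \<in> Lp_at p M F T \<tau>"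
  using xi_admissible xi_integrable
  by (simp add: admissible_family_def p_integrable_family_def Lp_at_def)

lemma rho_Lp: "\<sigma> \<in> Th \<Longrightarrow> \<tau> \<in> Th \<Longrightarrow> \<eta> \<in> Lp_at p M F T \<tau> \<Longrightarrow> \<rho> \<sigma> \<tau> \<eta> \<in> Lp_at p M F T \<sigma>"
  using rho_family by (simp add: operator_family_def)

lemma rho_cong:
  "\<sigma> \<in> Th \<Longrightarrow> \<tau> \<in> Th \<Longrightarrow> \<eta> \<in> Lp_at p M F T \<tau> \<Longrightarrow> \<eta>' \<in> Lp_at p M F T \<tau> \<Longrightarrow>
    AE \<omega> in M. \<eta> \<omega> = \<eta>' \<omega> \<Longrightarrow> AE \<omega> in M. \<rho> \<sigma> \<tau> \<eta> \<omega> = \<rho> \<sigma> \<tau> \<eta>' \<omega>"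
  using rho_family by (simp add: operator_family_def)

lemma rho_local:
  "\<sigma> \<in> Th \<Longrightarrow> \<sigma>' \<in> Th \<Longrightarrow> \<tau> \<in> Th \<Longrightarrow> \<eta> \<in> Lp_at p M F T \<tau> \<Longrightarrow>
    AE \<omega> in M. \<sigma> \<omega> = \<sigma>' \<omega> \<longrightarrow> \<rho> \<sigma> \<tau> \<eta> \<omega> = \<rho> \<sigma>' \<tau> \<eta> \<omega>"
  using rho_admissible by (simp add: op_admissible_def)

lemma rho_self: "\<tau> \<in> Th \<Longrightarrow> \<eta> \<in> Lp_at p M F T \<tau> \<Longrightarrow> AE \<omega> in M. \<rho> \<tau> \<tau> \<eta> \<omega> = \<eta> \<omega>"
  using rho_knowledge Th_from_self by (simp add: op_knowledge_preserving_def)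

lemma rho_mono:
  "\<sigma> \<in> Th \<Longrightarrow> \<tau> \<in> Th \<Longrightarrow> \<eta> \<in> Lp_at p M F T \<tau> \<Longrightarrow> \<eta>' \<in> Lp_at p M F T \<tau> \<Longrightarrow>
    AE \<omega> in M. \<eta> \<omega> \<le> \<eta>' \<omega> \<Longrightarrow> AE \<omega> in M. \<rho> \<sigma> \<tau> \<eta> \<omega> \<le> \<rho> \<sigma> \<tau> \<eta>' \<omega>"
  using rho_monotone by (simp add: op_monotone_def)

lemma rho_tower:
  "S \<in> Th \<Longrightarrow> \<sigma> \<in> Th_from S \<Longrightarrow> \<tau> \<in> Th_from \<sigma> \<Longrightarrow> \<eta> \<in> Lp_at p M F T \<tau> \<Longrightarrow>
    AE \<omega> in M. \<rho> S \<sigma> (\<rho> \<sigma> \<tau> \<eta>) \<omega> = \<rho> S \<tau> \<eta> \<omega>"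
  using rho_consistent by (simp add: op_consistent_def)

lemma zero_one:
  assumes "S \<in> Th" "A \<in> Fsets S" "\<tau> \<in> Th_from S" "\<tau>' \<in> Th_from S"
    and "AE \<omega> in M. \<omega> \<in> A \<longrightarrow> \<tau> \<omega> = \<tau>' \<omega>"
  shows "AE \<omega> in M. \<omega> \<in> A \<longrightarrow> \<rho> S \<tau> (\<xi> \<tau>) \<omega> = \<rho> S \<tau>' (\<xi> \<tau>') \<omega>"
proof -
  have "AE \<omega> in M. indicator A \<omega> * \<rho> S \<tau> (\<xi> \<tau>) \<omega> = indicator A \<omega> * \<rho> S \<tau>' (\<xi> \<tau>') \<omega>"
    using rho_zero_one xi_admissible xi_integrable assms unfolding op_zero_one_def by blast
  then show ?thesis by eventually_elim auto
qed

text \<open>\<open>rho_cong\<close> varies only the argument of one operator, whereas here the index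
  of the operator changes too. The zero-one law on the whole space bridges the two versions.\<close>

lemma reward_cong:
  assumes "S \<in> Th" "\<tau> \<in> Th_from S" "\<tau>' \<in> Th_from S" "AE \<omega> in M. \<tau> \<omega> = \<tau>' \<omega>"
  shows "AE \<omega> in M. \<rho> S \<tau> (\<xi> \<tau>) \<omega> = \<rho> S \<tau>' (\<xi> \<tau>') \<omega>"
  using zero_one[OF assms(1) Fsets_space assms(2,3)] assms(4) by auto

section \<open>Values along the grid and independence of the partition\<close>

lemma Ug_Lp: "k \<le> n \<Longrightarrow> Ug k \<in> Lp_at p M F T (\<theta> k)"
proof (induction k rule: inc_induct)
  case base
  show ?case using xi_Lp[OF theta_Th] by (simp add: Ug_end)
next
  case (step k)
  then have "\<xi> (\<theta> k) \<in> Lp_at p M F T (\<theta> k)"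
    "\<rho> (\<theta> k) (\<theta> (Suc k)) (Ug (Suc k)) \<in> Lp_at p M F T (\<theta> k)"
    by (auto intro!: xi_Lp rho_Lp theta_Th)
  then show ?case
    using step by (auto simp: Ug_step Lp_at_def intro!: Lp_max borel_measurable_max)
qed

lemma Ug_ge_xi: "k \<le> n \<Longrightarrow> \<xi> (\<theta> k) \<omega> \<le> Ug k \<omega>"
  by (cases "k = n") (auto simp: Ug_end Ug_step)

text \<open>Where the two times coincide, admissibility replaces the outer index
  \<open>\<theta> k\<close> by \<open>\<theta> (Suc k)\<close>, and knowledge preservation makes the
  operator the identity. The recursion becomes the maximum of \<open>\<xi>\<close> and
  \<open>Ug (Suc k)\<close> at the later time, which is \<open>Ug (Suc k)\<close> because it
  dominates \<open>\<xi>\<close>.\<close>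

lemma Ug_eq_Suc:
  assumes "k < n"
  shows "AE \<omega> in M. \<theta> k \<omega> = \<theta> (Suc k) \<omega> \<longrightarrow> Ug k \<omega> = Ug (Suc k) \<omega>"
proof -
  have Th: "\<theta> k \<in> Th" "\<theta> (Suc k) \<in> Th" and L: "Ug (Suc k) \<in> Lp_at p M F T (\<theta> (Suc k))"
    using assms by (auto intro: theta_Th Ug_Lp)
  show ?thesis
    using rho_local[OF Th(1,2,2) L] rho_self[OF Th(2) L] xi_cong[OF Th]
    by eventually_elim (use assms Ug_ge_xi[of "Suc k"] in \<open>auto simp: Ug_step max_def intro: antisym\<close>)
qed

text \<open>If two grid times coincide, monotonicity squeezes all times between them to the same
  value, so the one-step equalities chain.\<close>

lemma Ug_eq: "AE \<omega> in M. \<forall>i j. i \<le> j \<longrightarrow> j \<le> n \<longrightarrow> \<theta> i \<omega> = \<theta> j \<omega> \<longrightarrow> Ug i \<omega> = Ug j \<omega>"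
proof -
  have "AE \<omega> in M. \<forall>k<n. \<theta> k \<omega> = \<theta> (Suc k) \<omega> \<longrightarrow> Ug k \<omega> = Ug (Suc k) \<omega>"
    using Ug_eq_Suc by (auto simp: AE_all_countable)
  with theta_mono_AE show ?thesis
  proof eventually_elim
    case (elim \<omega>)
    have "Ug i \<omega> = Ug j \<omega>" if "i \<le> j" "j \<le> n" "\<theta> i \<omega> = \<theta> j \<omega>" for i j
      using that
    proof (induction j rule: dec_induct)
      case (step j)
      have "\<theta> i \<omega> \<le> \<theta> j \<omega>" "\<theta> j \<omega> \<le> \<theta> (Suc j) \<omega>"
        using elim(1) step.hyps(1) le_SucI[OF order_refl] by blast+
      then have "\<theta> i \<omega> = \<theta> j \<omega>" "\<theta> j \<omega> = \<theta> (Suc j) \<omega>" using step.prems by auto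
      then show ?case using step elim(2) by auto
    qed simp
    then show ?case by blast
  qed
qed

text \<open>The chosen partition may put a point into a cell j other than k, but then
  \<open>\<theta> j\<close> and \<open>\<theta> k\<close> agree there and \<open>Ug_eq\<close>
  applies. Later comparisons of values use this lemma in place of the choice inside
  \<open>U_fam\<close>.\<close>

lemma U_eq_Ug:
  assumes \<tau>: "\<tau> \<in> Th"
  shows "AE \<omega> in M. \<forall>k\<le>n. \<tau> \<omega> = \<theta> k \<omega> \<longrightarrow> U \<tau> \<omega> = Ug k \<omega>"
proof -
  define A where "A = (SOME A. grid_partition M F T \<theta> n \<tau> A)"
  have "\<exists>A. grid_partition M F T \<theta> n \<tau> A"
    using \<tau> by (intro grid_partition_exists) (auto simp: Theta_iff)
  then have A: "grid_partition M F T \<theta> n \<tau> A"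
    unfolding A_def by (rule someI_ex)
  then have disj: "disjoint_family_on A {..n}" and un: "(\<Union>k\<le>n. A k) = space M"
    and eq: "AE \<omega> in M. \<tau> \<omega> = (\<Sum>k\<le>n. \<theta> k \<omega> * indicator (A k) \<omega>)"
    by (auto simp: grid_partition_def)
  show ?thesis
    using eq Ug_eq AE_space
  proof eventually_elim
    case (elim \<omega>)
    obtain j where j: "j \<le> n" "\<omega> \<in> A j" using un elim(3) by blast
    have "U \<tau> \<omega> = Ug j \<omega>" "\<tau> \<omega> = \<theta> j \<omega>"
      using elim(1) sum_indicator_single[OF disj j] by (simp_all add: U_fam_def A_def Let_def)
    then show ?case
      using elim(2) j(1) by (metis nle_le)
  qed
qed

text \<open>The first hitting time is built backwards: stop at \<open>\<theta> k\<close> where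
  \<open>Ug k\<close> equals \<open>\<xi> (\<theta> k)\<close>, otherwise take the time constructed
  for \<open>Suc k\<close>. The first two clauses characterise it pathwise, which later identifies
  it as the least admissible time; the third is its optimality.\<close>

lemma first_hit:
  assumes "k \<le> n"
  shows "\<exists>\<sigma>\<in>Th_from (\<theta> k).
    (AE \<omega> in M. \<exists>j\<in>{k..n}. \<sigma> \<omega> = \<theta> j \<omega> \<and> Ug j \<omega> = \<xi> (\<theta> j) \<omega>) \<and>
    (AE \<omega> in M. \<forall>j\<in>{k..n}. Ug j \<omega> = \<xi> (\<theta> j) \<omega> \<longrightarrow> \<sigma> \<omega> \<le> \<theta> j \<omega>) \<and>
    (AE \<omega> in M. Ug k \<omega> = \<rho> (\<theta> k) \<sigma> (\<xi> \<sigma>) \<omega>)"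
  using assms
proof (induction k rule: inc_induct)
  case base
  have Th: "\<theta> n \<in> Th" by (rule theta_Th) simp
  have "AE \<omega> in M. Ug n \<omega> = \<rho> (\<theta> n) (\<theta> n) (\<xi> (\<theta> n)) \<omega>"
    using rho_self[OF Th xi_Lp[OF Th]] by eventually_elim (simp add: Ug_end)
  then show ?case
    using Th by (intro bexI[of _ "\<theta> n"] conjI) (auto simp: Ug_end intro: Th_from_self)
next
  case (step k)
  then obtain \<sigma> where \<sigma>: "\<sigma> \<in> Th_from (\<theta> (Suc k))"
    and hit: "AE \<omega> in M. \<exists>j\<in>{Suc k..n}. \<sigma> \<omega> = \<theta> j \<omega> \<and> Ug j \<omega> = \<xi> (\<theta> j) \<omega>"
    and first: "AE \<omega> in M. \<forall>j\<in>{Suc k..n}. Ug j \<omega> = \<xi> (\<theta> j) \<omega> \<longrightarrow> \<sigma> \<omega> \<le> \<theta> j \<omega>"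
    and opt: "AE \<omega> in M. Ug (Suc k) \<omega> = \<rho> (\<theta> (Suc k)) \<sigma> (\<xi> \<sigma>) \<omega>"
    by blast
  have k: "k < n" and Th: "\<theta> k \<in> Th" "\<theta> (Suc k) \<in> Th" "\<sigma> \<in> Th"
    using step \<sigma> by (auto intro: theta_Th Th_from_Th)
  have Suc: "\<theta> (Suc k) \<in> Th_from (\<theta> k)"
    using Th(2) theta_mono by (simp add: Theta_from_def)
  have \<sigma>k: "\<sigma> \<in> Th_from (\<theta> k)"
    by (rule Th_from_mono[OF theta_mono \<sigma>])
  define B where "B = {\<omega>\<in>space M. Ug k \<omega> = \<xi> (\<theta> k) \<omega>}"
  have [measurable]: "Ug k \<in> borel_measurable (F_at M F T (\<theta> k))" "\<xi> (\<theta> k) \<in> borel_measurable (F_at M F T (\<theta> k))"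
    using Ug_Lp[of k] xi_Lp[OF Th(1)] k by (auto simp: Lp_at_def)
  have "{\<omega>\<in>space (F_at M F T (\<theta> k)). Ug k \<omega> = \<xi> (\<theta> k) \<omega>} \<in> Fsets (\<theta> k)"
    by measurable
  then have B: "B \<in> Fsets (\<theta> k)" by (simp add: B_def space_F_at)
  then have Bc: "space M - B \<in> Fsets (\<theta> k)" using Fsets_space by (intro sets.Diff)
  define \<nu> where "\<nu> = (\<lambda>\<omega>. if \<omega> \<in> B then \<theta> k \<omega> else \<sigma> \<omega>)"
  have "\<nu> \<in> ST"
    unfolding \<nu>_def using Th B Th_from_le[OF \<sigma>k] by (intro ST_If) (auto intro: Th_ST)
  moreover have "AE \<omega> in M. \<exists>j\<le>n. \<nu> \<omega> = \<theta> j \<omega>"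
    using Theta_on_grid[OF Th(3)] by eventually_elim (use k in \<open>auto simp: \<nu>_def intro: less_imp_le\<close>)
  moreover have "AE \<omega> in M. \<theta> k \<omega> \<le> \<nu> \<omega>"
    using Th_from_le[OF \<sigma>k] by eventually_elim (auto simp: \<nu>_def)
  ultimately have \<nu>: "\<nu> \<in> Th_from (\<theta> k)" by (simp add: Theta_from_def Theta_iff)
  have "AE \<omega> in M. \<exists>j\<in>{k..n}. \<nu> \<omega> = \<theta> j \<omega> \<and> Ug j \<omega> = \<xi> (\<theta> j) \<omega>"
    using hit
  proof eventually_elim
    case (elim \<omega>)
    then show ?case
    proof (cases "\<omega> \<in> B")
      case True
      then show ?thesis using k by (intro bexI[of _ k]) (auto simp: \<nu>_def B_def)
    qed (use elim in \<open>auto simp: \<nu>_def\<close>)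
  qed
  moreover have "AE \<omega> in M. \<forall>j\<in>{k..n}. Ug j \<omega> = \<xi> (\<theta> j) \<omega> \<longrightarrow> \<nu> \<omega> \<le> \<theta> j \<omega>"
    using first theta_mono_AE AE_space
  proof eventually_elim
    case (elim \<omega>)
    show ?case
    proof (intro ballI impI)
      fix j assume j: "j \<in> {k..n}" "Ug j \<omega> = \<xi> (\<theta> j) \<omega>"
      show "\<nu> \<omega> \<le> \<theta> j \<omega>"
      proof (cases "\<omega> \<in> B")
        case True
        then show ?thesis using elim(2) j by (auto simp: \<nu>_def)
      next
        case False
        then have "j \<noteq> k" using j elim(3) by (auto simp: B_def)
        then show ?thesis using elim(1) j False by (auto simp: \<nu>_def)
      qed
    qed
  qed
  moreover have "AE \<omega> in M. Ug k \<omega> = \<rho> (\<theta> k) \<nu> (\<xi> \<nu>) \<omega>"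
  proof -
    have "AE \<omega> in M. \<omega> \<in> B \<longrightarrow> \<rho> (\<theta> k) \<nu> (\<xi> \<nu>) \<omega> = \<rho> (\<theta> k) (\<theta> k) (\<xi> (\<theta> k)) \<omega>"
      by (rule zero_one[OF Th(1) B \<nu> Th_from_self[OF Th(1)]]) (simp add: \<nu>_def)
    moreover have "AE \<omega> in M. \<omega> \<in> space M - B \<longrightarrow> \<rho> (\<theta> k) \<nu> (\<xi> \<nu>) \<omega> = \<rho> (\<theta> k) \<sigma> (\<xi> \<sigma>) \<omega>"
      by (rule zero_one[OF Th(1) Bc \<nu> \<sigma>k]) (simp add: \<nu>_def)
    \<comment> \<open>The induction hypothesis is inserted under the operator; consistency then
      merges the two operators into \<open>\<rho> (\<theta> k) \<sigma>\<close>.\<close>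
    moreover have "AE \<omega> in M. \<rho> (\<theta> k) (\<theta> (Suc k)) (Ug (Suc k)) \<omega>
        = \<rho> (\<theta> k) (\<theta> (Suc k)) (\<rho> (\<theta> (Suc k)) \<sigma> (\<xi> \<sigma>)) \<omega>"
      using k Th by (intro rho_cong opt) (auto intro: Ug_Lp rho_Lp xi_Lp)
    moreover note rho_tower[OF Th(1) Suc \<sigma> xi_Lp[OF Th(3)]] rho_self[OF Th(1) xi_Lp[OF Th(1)]] AE_space
    ultimately show ?thesis
    proof eventually_elim
      case (elim \<omega>)
      show ?case
      proof (cases "\<omega> \<in> B")
        case True
        then show ?thesis using elim(1,5) by (simp add: B_def)
      next
        case False
        \<comment> \<open>Off \<open>B\<close> the maximum in the recursion is not the immediate
          reward, so it is the continuation value.\<close>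
        then have "Ug k \<omega> \<noteq> \<xi> (\<theta> k) \<omega>" using elim(6) by (simp add: B_def)
        then have "Ug k \<omega> = \<rho> (\<theta> k) (\<theta> (Suc k)) (Ug (Suc k)) \<omega>"
          using fun_cong[OF Ug_step[OF k], of \<omega>] by linarith
        also have "\<dots> = \<rho> (\<theta> k) \<sigma> (\<xi> \<sigma>) \<omega>" using elim(3,4) by (rule trans)
        also have "\<dots> = \<rho> (\<theta> k) \<nu> (\<xi> \<nu>) \<omega>" using elim(2,6) False by simp
        finally show ?thesis .
      qed
    qed
  qed
  ultimately show ?case using \<nu> by blast
qed

text \<open>Where \<tau> stops at \<open>\<theta> k\<close> the reward is
  \<open>\<xi> (\<theta> k)\<close>. Elsewhere \<tau> has reached \<open>\<theta> (Suc k)\<close>,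
  and consistency, the induction hypothesis and monotonicity bound the reward by the continuation
  value. The zero-one law separates the two events.\<close>

lemma reward_le_Ug:
  assumes "k \<le> n" "\<tau> \<in> Th_from (\<theta> k)"
  shows "AE \<omega> in M. \<rho> (\<theta> k) \<tau> (\<xi> \<tau>) \<omega> \<le> Ug k \<omega>"
  using assms
proof (induction k arbitrary: \<tau> rule: inc_induct)
  case base
  have Th: "\<theta> n \<in> Th" by (rule theta_Th) simp
  have \<tau>: "\<tau> \<in> Th" using base by (rule Th_from_Th)
  \<comment> \<open>The time \<tau> is squeezed between \<open>\<theta> n\<close>, which is
    \<open>T\<close> almost surely, and the upper end of its range.\<close>
  have "AE \<omega> in M. \<tau> \<omega> = \<theta> n \<omega>"
    using Th_from_le[OF base] theta_end[OF order_refl] AE_space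
    by eventually_elim (use ST_range[OF Th_ST[OF \<tau>]] in \<open>auto intro: antisym\<close>)
  then show ?case
    using reward_cong[OF Th base Th_from_self[OF Th]] rho_self[OF Th xi_Lp[OF Th]]
    by (auto simp: Ug_end elim: eventually_elim2)
next
  case (step k)
  have k: "k < n" and Th: "\<theta> k \<in> Th" "\<theta> (Suc k) \<in> Th" "\<tau> \<in> Th"
    using step by (auto intro: theta_Th Th_from_Th)
  have Suc: "\<theta> (Suc k) \<in> Th_from (\<theta> k)"
    using Th(2) theta_mono by (simp add: Theta_from_def)
  define B where "B = {\<omega>\<in>space M. \<tau> \<omega> = \<theta> k \<omega>}"
  have B: "B \<in> Fsets (\<theta> k)"
    unfolding B_def by (intro Fsets_eq Th_ST Th)
  then have Bc: "space M - B \<in> Fsets (\<theta> k)" using Fsets_space by (intro sets.Diff)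
  \<comment> \<open>The induction hypothesis and consistency need a time beyond
    \<open>\<theta> (Suc k)\<close> almost surely, not only off \<open>B\<close>.\<close>
  define \<sigma> where "\<sigma> = (\<lambda>\<omega>. max (\<theta> (Suc k) \<omega>) (\<tau> \<omega>))"
  have \<sigma>: "\<sigma> \<in> Th_from (\<theta> (Suc k))"
    unfolding \<sigma>_def by (rule Th_max_from[OF Th(2,3)])
  have \<sigma>k: "\<sigma> \<in> Th_from (\<theta> k)"
    by (rule Th_from_mono[OF theta_mono \<sigma>])
  have eq: "AE \<omega> in M. \<omega> \<in> space M - B \<longrightarrow> \<tau> \<omega> = \<sigma> \<omega>"
    using Th_from_le[OF step.prems] Theta_on_grid[OF Th(3)] theta_mono_AE
  proof eventually_elim
    case (elim \<omega>)
    then obtain j where j: "j \<le> n" "\<tau> \<omega> = \<theta> j \<omega>" by blast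
    \<comment> \<open>A grid index j \<le> k would give \<tau> \<le> \<open>\<theta> k\<close>,
      hence equality; so \<tau> cannot lie strictly between consecutive grid times.\<close>
    have "\<theta> (Suc k) \<omega> \<le> \<tau> \<omega>" if "\<tau> \<omega> \<noteq> \<theta> k \<omega>"
    proof -
      have "\<not> j \<le> k" using elim j that by (metis antisym)
      then show ?thesis using elim(3) j by auto
    qed
    then show ?case by (auto simp: B_def \<sigma>_def)
  qed
  have L: "\<xi> \<sigma> \<in> Lp_at p M F T \<sigma>" by (rule xi_Lp[OF Th_from_Th[OF \<sigma>]])
  have "AE \<omega> in M. \<rho> (\<theta> k) (\<theta> (Suc k)) (\<rho> (\<theta> (Suc k)) \<sigma> (\<xi> \<sigma>)) \<omega>
      \<le> \<rho> (\<theta> k) (\<theta> (Suc k)) (Ug (Suc k)) \<omega>"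
    using k by (intro rho_mono Th step.IH \<sigma> Ug_Lp rho_Lp Th_from_Th[OF \<sigma>] L) auto
  moreover note rho_tower[OF Th(1) Suc \<sigma> L] zero_one[OF Th(1) Bc step.prems \<sigma>k eq]
    rho_self[OF Th(1) xi_Lp[OF Th(1)]] AE_space
  moreover have "AE \<omega> in M. \<omega> \<in> B \<longrightarrow> \<rho> (\<theta> k) \<tau> (\<xi> \<tau>) \<omega> = \<rho> (\<theta> k) (\<theta> k) (\<xi> (\<theta> k)) \<omega>"
    by (rule zero_one[OF Th(1) B step.prems Th_from_self[OF Th(1)]]) (simp add: B_def)
  ultimately show ?case
  proof eventually_elim
    case (elim \<omega>)
    then show ?case
      using k by (cases "\<omega> \<in> B") (auto simp: Ug_step)
  qed
qed

text \<open>On the event that \<nu> equals \<open>\<theta> k\<close>, admissibility exchanges the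
  outer index and the bound at \<open>\<theta> k\<close> applies. Since \<tau> is known to follow
  \<open>\<theta> k\<close> only on this event, it is first replaced by its maximum with
  \<open>\<theta> k\<close>, which changes nothing there. Finitely many such events cover almost all
  of the space.\<close>

lemma reward_le_U:
  assumes \<nu>: "\<nu> \<in> Th" and \<tau>: "\<tau> \<in> Th_from \<nu>"
  shows "AE \<omega> in M. \<rho> \<nu> \<tau> (\<xi> \<tau>) \<omega> \<le> U \<nu> \<omega>"
proof -
  have "AE \<omega> in M. \<nu> \<omega> = \<theta> k \<omega> \<longrightarrow> \<rho> \<nu> \<tau> (\<xi> \<tau>) \<omega> \<le> Ug k \<omega>" if k: "k \<le> n" for k
  proof -
    have Th: "\<theta> k \<in> Th" "\<tau> \<in> Th" using k \<tau> by (auto intro: theta_Th Th_from_Th)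
    define \<sigma> where "\<sigma> = (\<lambda>\<omega>. max (\<theta> k \<omega>) (\<tau> \<omega>))"
    have \<sigma>: "\<sigma> \<in> Th_from (\<theta> k)" "\<sigma> \<in> Th_from \<tau>"
      unfolding \<sigma>_def by (rule Th_max_from[OF Th])+
    have \<sigma>\<nu>: "\<sigma> \<in> Th_from \<nu>" by (rule Th_from_mono[OF Th_from_le[OF \<tau>] \<sigma>(2)])
    have B: "{\<omega>\<in>space M. \<theta> k \<omega> = \<nu> \<omega>} \<in> Fsets \<nu>" by (intro Fsets_eq Th_ST Th \<nu>)
    have "AE \<omega> in M. \<omega> \<in> {\<omega>\<in>space M. \<theta> k \<omega> = \<nu> \<omega>} \<longrightarrow> \<tau> \<omega> = \<sigma> \<omega>"
      using Th_from_le[OF \<tau>] by eventually_elim (auto simp: \<sigma>_def)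
    from zero_one[OF \<nu> B \<tau> \<sigma>\<nu> this] rho_local[OF \<nu> Th(1) Th_from_Th xi_Lp[OF Th_from_Th], OF \<sigma>(1,1)]
      reward_le_Ug[OF k \<sigma>(1)] AE_space
    show ?thesis by eventually_elim auto
  qed
  then have "AE \<omega> in M. \<forall>k\<le>n. \<nu> \<omega> = \<theta> k \<omega> \<longrightarrow> \<rho> \<nu> \<tau> (\<xi> \<tau>) \<omega> \<le> Ug k \<omega>"
    by (auto simp: AE_all_countable)
  with U_eq_Ug[OF \<nu>] Theta_on_grid[OF \<nu>] show ?thesis
    by eventually_elim auto
qed

text \<open>The optimal time from \<open>\<theta> k\<close> is raised to \<nu>, which does not alter
  it where \<nu> equals \<open>\<theta> k\<close>. Attainment on one such event at a time suffices,
  because an upper bound of all rewards can be compared with \<open>U \<nu>\<close> event by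
  event.\<close>

lemma U_reward_attained:
  assumes \<nu>: "\<nu> \<in> Th" and k: "k \<le> n"
  shows "\<exists>\<tau>\<in>Th_from \<nu>. AE \<omega> in M. \<nu> \<omega> = \<theta> k \<omega> \<longrightarrow> \<rho> \<nu> \<tau> (\<xi> \<tau>) \<omega> = U \<nu> \<omega>"
proof -
  obtain \<sigma> where \<sigma>: "\<sigma> \<in> Th_from (\<theta> k)" and opt: "AE \<omega> in M. Ug k \<omega> = \<rho> (\<theta> k) \<sigma> (\<xi> \<sigma>) \<omega>"
    using first_hit[OF k] by blast
  have Th: "\<theta> k \<in> Th" "\<sigma> \<in> Th" using k \<sigma> by (auto intro: theta_Th Th_from_Th)
  define \<tau> where "\<tau> = (\<lambda>\<omega>. max (\<nu> \<omega>) (\<sigma> \<omega>))"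
  have \<tau>: "\<tau> \<in> Th_from \<nu>" "\<tau> \<in> Th_from \<sigma>"
    unfolding \<tau>_def by (rule Th_max_from[OF \<nu> Th(2)])+
  have \<tau>k: "\<tau> \<in> Th_from (\<theta> k)" by (rule Th_from_mono[OF Th_from_le[OF \<sigma>] \<tau>(2)])
  have B: "{\<omega>\<in>space M. \<nu> \<omega> = \<theta> k \<omega>} \<in> Fsets (\<theta> k)" by (intro Fsets_eq Th_ST Th \<nu>)
  have "AE \<omega> in M. \<omega> \<in> {\<omega>\<in>space M. \<nu> \<omega> = \<theta> k \<omega>} \<longrightarrow> \<tau> \<omega> = \<sigma> \<omega>"
    using Th_from_le[OF \<sigma>] by eventually_elim (auto simp: \<tau>_def)
  from zero_one[OF Th(1) B \<tau>k \<sigma> this] rho_local[OF \<nu> Th(1) Th_from_Th xi_Lp[OF Th_from_Th], OF \<tau>(1,1)]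
    opt AE_space U_eq_Ug[OF \<nu>]
  have "AE \<omega> in M. \<nu> \<omega> = \<theta> k \<omega> \<longrightarrow> \<rho> \<nu> \<tau> (\<xi> \<tau>) \<omega> = U \<nu> \<omega>"
    by eventually_elim (use k in auto)
  with \<tau>(1) show ?thesis by blast
qed

section \<open>Identification of the essential supremum and of the essential infima\<close>

lemma U_measurable:
  assumes \<nu>: "\<nu> \<in> Th"
  shows "U \<nu> \<in> borel_measurable M"
proof -
  define A where "A = (SOME A. grid_partition M F T \<theta> n \<nu> A)"
  have "\<exists>A. grid_partition M F T \<theta> n \<nu> A"
    using \<nu> by (intro grid_partition_exists) (auto simp: Theta_iff)
  then have "grid_partition M F T \<theta> n \<nu> A"
    unfolding A_def by (rule someI_ex)
  then have A: "A k \<in> Fsets (\<theta> k)" if "k \<le> n" for k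
    using that by (simp add: grid_partition_def)
  have "Fsets (\<theta> k) \<subseteq> sets M" for k
  proof
    fix E assume E: "E \<in> Fsets (\<theta> k)"
    then have "{\<omega>\<in>E. \<theta> k \<omega> \<le> T} \<in> sets M"
      using sets_frozen by (auto simp: Fsets_iff theta_stopping)
    also have "{\<omega>\<in>E. \<theta> k \<omega> \<le> T} = E"
      using Fsets_subset[OF E] ST_range[OF theta_stopping] by auto
    finally show "E \<in> sets M" .
  qed
  then have [measurable]: "A k \<in> sets M" if "k \<le> n" for k using A that by blast
  have [measurable]: "Ug k \<in> borel_measurable M" if "k \<le> n" for k
    using Ug_Lp[OF that] by (simp add: Lp_at_def Lp_def)
  have "(\<lambda>\<omega>. \<Sum>k\<le>n. Ug k \<omega> * indicator (A k) \<omega>) \<in> borel_measurable M"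
    by (intro borel_measurable_sum borel_measurable_times borel_measurable_indicator) auto
  then show ?thesis by (simp add: U_fam_def A_def Let_def)
qed

text \<open>\<open>U \<nu>\<close> is itself a version of the essential supremum: it bounds all
  rewards, and on each event where \<nu> equals a grid time it is one of them.\<close>

lemma U_eq_V:
  assumes \<nu>: "\<nu> \<in> Th"
  shows "AE \<omega> in M. ereal (U \<nu> \<omega>) = V \<nu> \<omega>"
proof -
  let ?\<Phi> = "{(\<lambda>\<omega>. ereal (\<rho> \<nu> \<tau> (\<xi> \<tau>) \<omega>)) |\<tau>. \<tau> \<in> Th_from \<nu>}"
  have "is_ess_sup M UNIV ?\<Phi> (\<lambda>\<omega>. ereal (U \<nu> \<omega>))"
    unfolding is_ess_sup_def
  proof (intro conjI ballI impI)
    show "(\<lambda>\<omega>. ereal (U \<nu> \<omega>)) \<in> measurable M (restrict_space borel UNIV)"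
      using U_measurable[OF \<nu>] by (simp add: measurable_restrict_space2_iff)
    show "AE \<omega> in M. X \<omega> \<le> ereal (U \<nu> \<omega>)" if "X \<in> ?\<Phi>" for X
      using that reward_le_U[OF \<nu>] by auto
    fix Z assume Z: "\<forall>X\<in>?\<Phi>. AE \<omega> in M. X \<omega> \<le> Z \<omega>"
    have "AE \<omega> in M. \<nu> \<omega> = \<theta> k \<omega> \<longrightarrow> ereal (U \<nu> \<omega>) \<le> Z \<omega>" if k: "k \<le> n" for k
    proof -
      obtain \<tau> where \<tau>: "\<tau> \<in> Th_from \<nu>"
        and eq: "AE \<omega> in M. \<nu> \<omega> = \<theta> k \<omega> \<longrightarrow> \<rho> \<nu> \<tau> (\<xi> \<tau>) \<omega> = U \<nu> \<omega>"
        using U_reward_attained[OF \<nu> k] by blast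
      have "AE \<omega> in M. ereal (\<rho> \<nu> \<tau> (\<xi> \<tau>) \<omega>) \<le> Z \<omega>" using Z \<tau> by auto
      with eq show ?thesis by eventually_elim auto
    qed
    then have "AE \<omega> in M. \<forall>k\<le>n. \<nu> \<omega> = \<theta> k \<omega> \<longrightarrow> ereal (U \<nu> \<omega>) \<le> Z \<omega>"
      by (auto simp: AE_all_countable)
    with Theta_on_grid[OF \<nu>] show "AE \<omega> in M. ereal (U \<nu> \<omega>) \<le> Z \<omega>"
      by eventually_elim auto
  qed
  from is_ess_sup_unique[OF this is_ess_sup_ess_sup[OF this]] show ?thesis
    by (simp add: V_fam_def)
qed

text \<open>Since \<open>U\<close> and \<open>V\<close> agree almost surely, both infima are taken
  over the same set of times. The same choice is then made, so the equality holds
  everywhere.\<close>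

lemma nu_eq_nu_bar: "nu M F T \<theta> \<rho> \<xi> k = nu_bar M F T \<theta> \<rho> \<xi> n k"
proof -
  have "(AE \<omega> in M. V \<tau> \<omega> = ereal (\<xi> \<tau> \<omega>)) \<longleftrightarrow> (AE \<omega> in M. U \<tau> \<omega> = \<xi> \<tau> \<omega>)" if "\<tau> \<in> Th" for \<tau>
    using U_eq_V[OF that] by (intro eventually_subst) (auto elim: eventually_mono)
  then show ?thesis
    unfolding nu_def nu_bar_def
    by (intro arg_cong[where f="ess_inf M {0..T}"] Collect_cong conj_cong refl) (blast dest: Th_from_Th)
qed

text \<open>The first hitting time belongs to the set of times whose infimum is taken and lies below
  all its members. It is thus a version of the infimum, and its optimality passes to the chosen
  version.\<close>

lemma nu_bar_optimal:
  assumes k: "k \<le> n"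
  defines "\<nu> \<equiv> nu_bar M F T \<theta> \<rho> \<xi> n k"
  shows "\<nu> \<in> Th" "AE \<omega> in M. Ug k \<omega> = \<rho> (\<theta> k) \<nu> (\<xi> \<nu>) \<omega>"
proof -
  let ?\<Phi> = "{\<tau> \<in> Th_from (\<theta> k). AE \<omega> in M. U \<tau> \<omega> = \<xi> \<tau> \<omega>}"
  obtain \<sigma> where \<sigma>: "\<sigma> \<in> Th_from (\<theta> k)"
    and hit: "AE \<omega> in M. \<exists>j\<in>{k..n}. \<sigma> \<omega> = \<theta> j \<omega> \<and> Ug j \<omega> = \<xi> (\<theta> j) \<omega>"
    and first: "AE \<omega> in M. \<forall>j\<in>{k..n}. Ug j \<omega> = \<xi> (\<theta> j) \<omega> \<longrightarrow> \<sigma> \<omega> \<le> \<theta> j \<omega>"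
    and opt: "AE \<omega> in M. Ug k \<omega> = \<rho> (\<theta> k) \<sigma> (\<xi> \<sigma>) \<omega>"
    using first_hit[OF k] by blast
  have xi_grid: "AE \<omega> in M. \<forall>j\<le>n. \<tau> \<omega> = \<theta> j \<omega> \<longrightarrow> \<xi> \<tau> \<omega> = \<xi> (\<theta> j) \<omega>" if "\<tau> \<in> Th" for \<tau>
    using xi_cong[OF that theta_Th] by (auto simp: AE_all_countable)
  have Th: "\<theta> k \<in> Th" "\<sigma> \<in> Th" using k \<sigma> by (auto intro: theta_Th Th_from_Th)
  have "AE \<omega> in M. U \<sigma> \<omega> = \<xi> \<sigma> \<omega>"
    using hit U_eq_Ug[OF Th(2)] xi_grid[OF Th(2)] by eventually_elim auto
  then have \<sigma>\<Phi>: "\<sigma> \<in> ?\<Phi>" using \<sigma> by blast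
  have min: "AE \<omega> in M. \<sigma> \<omega> \<le> \<tau> \<omega>" if "\<tau> \<in> ?\<Phi>" for \<tau>
  proof -
    have \<tau>: "\<tau> \<in> Th" and le: "AE \<omega> in M. \<theta> k \<omega> \<le> \<tau> \<omega>" and U: "AE \<omega> in M. U \<tau> \<omega> = \<xi> \<tau> \<omega>"
      using that by (auto simp: Theta_from_def)
    show ?thesis
      using le U first U_eq_Ug[OF \<tau>] xi_grid[OF \<tau>] Theta_on_grid[OF \<tau>] theta_mono_AE
    proof eventually_elim
      case (elim \<omega>)
      then obtain i where i: "i \<le> n" "\<tau> \<omega> = \<theta> i \<omega>" by blast
      \<comment> \<open>The property \<open>first\<close> concerns only indices from k on. If i < k,
        then \<open>\<theta> k\<close> \<le> \<tau> = \<open>\<theta> i\<close> \<le>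
        \<open>\<theta> k\<close>, so raising the index does not change the time.\<close>
      define j where "j = max i k"
      have j: "j \<in> {k..n}" using i k by (auto simp: j_def)
      have "\<tau> \<omega> = \<theta> j \<omega>"
        using elim(1,7) i by (cases "i \<le> k") (auto simp: j_def max_def intro: antisym)
      then show ?case using elim j by auto
    qed
  qed
  have "is_ess_inf M {0..T} ?\<Phi> \<sigma>"
    unfolding is_ess_inf_def using ST_measurable[OF Th_ST[OF Th(2)]] min \<sigma>\<Phi> by blast
  note inf = this is_ess_inf_ess_inf[OF this]
  have eq: "AE \<omega> in M. \<nu> \<omega> = \<sigma> \<omega>"
    using is_ess_inf_unique[OF inf(2,1)] by (simp add: \<nu>_def nu_bar_def)
  have "\<nu> \<in> measurable M (restrict_space borel {0..T})"
    using inf(2) by (simp add: is_ess_inf_def \<nu>_def nu_bar_def)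
  \<comment> \<open>Taking the infimum among \<open>{0..T}\<close>-valued variables keeps the chosen
    version in the interval everywhere, as \<open>Th_AE_cong\<close> requires.\<close>
  from measurable_space[OF this] have range: "\<nu> \<omega> \<in> {0..T}" if "\<omega> \<in> space M" for \<omega>
    using that by (simp add: space_restrict_space)
  show \<nu>: "\<nu> \<in> Th" by (rule Th_AE_cong[OF Th(2) range eq])
  have "AE \<omega> in M. \<theta> k \<omega> \<le> \<nu> \<omega>"
    using Th_from_le[OF \<sigma>] eq by eventually_elim auto
  with \<nu> have "\<nu> \<in> Th_from (\<theta> k)" by (simp add: Theta_from_def)
  from reward_cong[OF Th(1) this \<sigma> eq] opt
  show "AE \<omega> in M. Ug k \<omega> = \<rho> (\<theta> k) \<nu> (\<xi> \<nu>) \<omega>" by eventually_elim auto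
qed

lemma Ug_eq_V:
  assumes "k \<le> n"
  shows "AE \<omega> in M. ereal (Ug k \<omega>) = V (\<theta> k) \<omega>"
  using U_eq_V[OF theta_Th[OF assms]] U_eq_Ug[OF theta_Th[OF assms]]
  by eventually_elim (use assms in auto)

end

theorem theorem4p3:
  fixes M :: "'a measure" and F :: "real \<Rightarrow> 'a measure" and T :: real
    and \<theta> :: "nat \<Rightarrow> 'a \<Rightarrow> real" and p :: ennreal
    and \<rho> :: "'a operators" and \<xi> :: "('a \<Rightarrow> real) \<Rightarrow> 'a \<Rightarrow> real" and n :: nat
  assumes "stopping_grid M F T \<theta>"
    and "1 \<le> p"
    and "1 \<le> n"
    and "\<forall>m\<ge>n. AE \<omega> in M. \<theta> m \<omega> = T"
    and "admissible_family M F T \<theta> \<xi>"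
    and "p_integrable_family p M F T \<theta> \<xi>"
    and "operator_family p M F T \<theta> \<rho>"
    and "op_admissible p M F T \<theta> \<rho>"
    and "op_knowledge_preserving p M F T \<theta> \<rho>"
    and "op_monotone p M F T \<theta> \<rho>"
    and "op_consistent p M F T \<theta> \<rho>"
    and "op_zero_one p M F T \<theta> \<rho>"
  shows "(\<forall>k\<le>n.
            nu_bar M F T \<theta> \<rho> \<xi> n k \<in> Theta M F T \<theta> \<and>
            (AE \<omega> in M. U_grid \<rho> \<theta> \<xi> n k \<omega>
               = \<rho> (\<theta> k) (nu_bar M F T \<theta> \<rho> \<xi> n k) (\<xi> (nu_bar M F T \<theta> \<rho> \<xi> n k)) \<omega>) \<and>
            (AE \<omega> in M. ereal (U_grid \<rho> \<theta> \<xi> n k \<omega>) = V_fam M F T \<theta> \<rho> \<xi> (\<theta> k) \<omega>)) \<and>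
         (\<forall>\<tau>\<in>Theta M F T \<theta>.
            AE \<omega> in M. ereal (U_fam M F T \<theta> \<rho> \<xi> n \<tau> \<omega>) = V_fam M F T \<theta> \<rho> \<xi> \<tau> \<omega>) \<and>
         (\<forall>k\<le>n. AE \<omega> in M. nu_bar M F T \<theta> \<rho> \<xi> n k \<omega> = nu M F T \<theta> \<rho> \<xi> k \<omega>)"
proof -
  interpret grid: stopping_grid M F T \<theta> by fact
  interpret optimal_stopping M F T \<theta> n p \<rho> \<xi>
    by unfold_locales (use assms in auto)
  show ?thesis
    unfolding nu_eq_nu_bar using nu_bar_optimal Ug_eq_V U_eq_V by blast
qed

end
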